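(* Every isothermic cylinder $f(u,v)$ with one generic family of closed planar curvature $u$-lines (in the normal form of the context) has the following geometric properties. (1) The $v$-curve $f(\omega,v)$ defined by critical $u=\omega$ lies on a sphere (centered at the origin) of radius $|R(\omega)|$, where $R(\omega)$ is the real number $$R(\omega)=\frac{2\vartheta_2(\omega)^2}{\vartheta_1'(0)\vartheta_1(2\omega)}.$$ Moreover, $f(\omega,v)$ and $f_u(\omega,v)$ are parallel and satisfy $$\frac{1}{R(\omega)}f(\omega,v)=-\frac{f_u(\omega,v)}{|f_u(\omega,v)|}.$$ (2) Define $f^{\mathrm{inv}}=-R(\omega)^2f^{-1}$ (quaternionic inverse), the inversion of $f$ in the sphere of radius $|R(\omega)|$ centered at the origin. Then $$f^{\mathrm{inv}}(u,v)=f(2\omega-u,v).$$ In other words, this inversion maps $f$ onto itself and is an involution. The plane of each $u$-curve is mapped to itself. (3) A Christoffel dual $f^*$ of $f$, with $(f^* )_u=\frac{f_u}{|f_u|^2}$ and $(f^* )_v=-\frac{f_v}{|f_v|^2}$, is $$f^*(u,v)=-f(\pi-u,v).$$ In other words, this duality maps $f$ onto (minus) itself and is an involution. The plane of each $u$-curve is mapped to itself.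
   Context: Theta functions (Whittaker–Watson convention): for $\operatorname{Im}\tau>0$, $q=e^{i\pi\tau}$, $q^{c}=e^{i\pi\tau c}$, $\vartheta_1(z|\tau)=2\sum_{n\ge0}(-1)^nq^{(n+1/2)^2}\sin((2n+1)z)$, $\vartheta_2(z|\tau)=2\sum_{n\ge0}q^{(n+1/2)^2}\cos((2n+1)z)$; primes denote $d/dz$. Quaternions: $\mathbb{H}$ has basis $1,\mathbf i,\mathbf j,\mathbf k$ with $\mathbf{ij}=\mathbf k$, etc. $\mathbb{R}^3$ is identified with the imaginary quaternions and $\mathbb{C}$ with $\mathrm{span}\{1,\mathbf i\}$ ($i=\mathbf i$). Normal form of an isothermic (conformal curvature line parametrized) cylinder with one generic family ($u$-curves, $f(u+2\pi,v)=f(u,v)$) of closed planar curvature lines (generic: normals of the curvature line planes span three dimensional space): $$f(u,v)=\Phi^{-1}(v)\,\gamma(u,\mathrm{w}(v))\,\mathbf j\,\Phi(v),\qquad \gamma(u,\mathrm{w})=-i\frac{2\vartheta_2(\omega)^2}{\vartheta_1'(0)\vartheta_1(2\omega)}\frac{\vartheta_1\left(\frac12(u+i\mathrm{w}-3\omega)\right)}{\vartheta_1\left(\frac12(u+i\mathrm{w}+\omega)\right)},$$ $$\Phi'(v)\Phi^{-1}(v)=\sqrt{1-\mathrm{w}'(v)^2}\,W_1(\mathrm{w}(v))\,\mathbf k,\qquad W_1(\mathrm{w})=i\frac{\vartheta_1'(0)}{2\vartheta_2(\omega)}\frac{\vartheta_2(\omega-i\mathrm{w})}{\vartheta_1(i\mathrm{w})},$$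 with $\Phi$ nonvanishing quaternion valued. Here $\tau\in\frac12+i\mathbb{R}$, $0<\operatorname{Im}\tau<\operatorname{Im}\tau_0\approx0.3547$ (where $\tau_0\in\frac12+i\mathbb{R}$, $\vartheta_2''(0|\tau_0)=0$), and $\omega\in(0,\pi/4)$ is the unique critical value with $\vartheta_2'(\omega|\tau)=0$. The function $\mathrm{w}$ is $\tau$-admissible: $\mathrm{w}:\mathbb{R}\to(0,2\pi\operatorname{Im}\tau)$ is smooth and $\sqrt{1-\mathrm{w}'^2}:\mathbb{R}\to\mathbb{R}$ is a smooth (possibly sign changing) real square root. *)

theory Defs
  imports "HOL-Analysis.Analysis"
begin

section \<open>Quaternions\<close>

datatype quat = Quat (q_re: real) (q_i: real) (q_j: real) (q_k: real)

lemma quat_eq_iff: "x = y \<longleftrightarrow> q_re x = q_re y \<and> q_i x = q_i y \<and> q_j x = q_j y \<and> q_k x = q_k y"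
  by (cases x; cases y) simp

instantiation quat :: "{zero, one, plus, minus, uminus, times, scaleR, inverse}"
begin

definition zero_quat :: quat where "0 = Quat 0 0 0 0"
definition one_quat :: quat where "1 = Quat 1 0 0 0"
definition plus_quat :: "quat \<Rightarrow> quat \<Rightarrow> quat" where
  "x + y = Quat (q_re x + q_re y) (q_i x + q_i y) (q_j x + q_j y) (q_k x + q_k y)"
definition minus_quat :: "quat \<Rightarrow> quat \<Rightarrow> quat" where
  "x - y = Quat (q_re x - q_re y) (q_i x - q_i y) (q_j x - q_j y) (q_k x - q_k y)"
definition uminus_quat :: "quat \<Rightarrow> quat" where
  "- x = Quat (- q_re x) (- q_i x) (- q_j x) (- q_k x)"
definition times_quat :: "quat \<Rightarrow> quat \<Rightarrow> quat" where
  "x * y = Quat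
     (q_re x * q_re y - q_i x * q_i y - q_j x * q_j y - q_k x * q_k y)
     (q_re x * q_i y + q_i x * q_re y + q_j x * q_k y - q_k x * q_j y)
     (q_re x * q_j y - q_i x * q_k y + q_j x * q_re y + q_k x * q_i y)
     (q_re x * q_k y + q_i x * q_j y - q_j x * q_i y + q_k x * q_re y)"
definition scaleR_quat :: "real \<Rightarrow> quat \<Rightarrow> quat" where
  "r *\<^sub>R x = Quat (r * q_re x) (r * q_i x) (r * q_j x) (r * q_k x)"
definition inverse_quat :: "quat \<Rightarrow> quat" where
  "inverse x = (1 / ((q_re x)\<^sup>2 + (q_i x)\<^sup>2 + (q_j x)\<^sup>2 + (q_k x)\<^sup>2)) *\<^sub>R
     Quat (q_re x) (- q_i x) (- q_j x) (- q_k x)"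
definition divide_quat :: "quat \<Rightarrow> quat \<Rightarrow> quat" where
  "x div y = x * inverse y" for x y :: quat

instance ..

end

lemma quat_zero_sel [simp]: "q_re 0 = 0" "q_i 0 = 0" "q_j 0 = 0" "q_k 0 = 0"
  by (simp_all add: zero_quat_def)

lemma quat_one_sel [simp]: "q_re 1 = 1" "q_i 1 = 0" "q_j 1 = 0" "q_k 1 = 0"
  by (simp_all add: one_quat_def)

lemma quat_plus_sel [simp]:
  "q_re (x + y) = q_re x + q_re y" "q_i (x + y) = q_i x + q_i y"
  "q_j (x + y) = q_j x + q_j y" "q_k (x + y) = q_k x + q_k y"
  by (simp_all add: plus_quat_def)

lemma quat_minus_sel [simp]:
  "q_re (x - y) = q_re x - q_re y" "q_i (x - y) = q_i x - q_i y"
  "q_j (x - y) = q_j x - q_j y" "q_k (x - y) = q_k x - q_k y"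
  by (simp_all add: minus_quat_def)

lemma quat_uminus_sel [simp]:
  "q_re (- x) = - q_re x" "q_i (- x) = - q_i x" "q_j (- x) = - q_j x" "q_k (- x) = - q_k x"
  by (simp_all add: uminus_quat_def)

lemma quat_scaleR_sel [simp]:
  "q_re (r *\<^sub>R x) = r * q_re x" "q_i (r *\<^sub>R x) = r * q_i x"
  "q_j (r *\<^sub>R x) = r * q_j x" "q_k (r *\<^sub>R x) = r * q_k x"
  by (simp_all add: scaleR_quat_def)

lemma quat_times_sel [simp]:
  "q_re (x * y) = q_re x * q_re y - q_i x * q_i y - q_j x * q_j y - q_k x * q_k y"
  "q_i (x * y) = q_re x * q_i y + q_i x * q_re y + q_j x * q_k y - q_k x * q_j y"
  "q_j (x * y) = q_re x * q_j y - q_i x * q_k y + q_j x * q_re y + q_k x * q_i y"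
  "q_k (x * y) = q_re x * q_k y + q_i x * q_j y - q_j x * q_i y + q_k x * q_re y"
  by (simp_all add: times_quat_def)

lemma quat_sum_squares_eq_0:
  "(q_re x)\<^sup>2 + (q_i x)\<^sup>2 + (q_j x)\<^sup>2 + (q_k x)\<^sup>2 = 0 \<longleftrightarrow> x = 0"
  by (auto simp: quat_eq_iff add_nonneg_eq_0_iff)

instance quat :: real_algebra_1
  by intro_classes (auto simp: quat_eq_iff algebra_simps)

instance quat :: real_div_algebra
proof
  fix x y :: quat
  define n where "n = (q_re x)\<^sup>2 + (q_i x)\<^sup>2 + (q_j x)\<^sup>2 + (q_k x)\<^sup>2"
  define c where "c = Quat (q_re x) (- q_i x) (- q_j x) (- q_k x)"
  have inv: "inverse x = (1 / n) *\<^sub>R c"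
    by (simp add: inverse_quat_def n_def c_def)
  have mult: "c * x = n *\<^sub>R 1" "x * c = n *\<^sub>R 1"
    by (simp_all add: quat_eq_iff c_def n_def power2_eq_square)
  have n: "n \<noteq> 0" if "x \<noteq> 0"
    using that by (simp add: n_def quat_sum_squares_eq_0)
  show "inverse x * x = 1" if "x \<noteq> 0"
    using n[OF that] by (simp add: inv mult)
  show "x * inverse x = 1" if "x \<noteq> 0"
    using n[OF that] by (simp add: inv mult)
  show "x / y = x * inverse y"
    by (simp add: divide_quat_def)
  show "inverse (0 :: quat) = 0"
    by (simp add: inverse_quat_def quat_eq_iff)
qed

instantiation quat :: real_inner
begin

definition inner_quat :: "quat \<Rightarrow> quat \<Rightarrow> real" where
  "x \<bullet> y = q_re x * q_re y + q_i x * q_i y + q_j x * q_j y + q_k x * q_k y"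
definition norm_quat :: "quat \<Rightarrow> real" where
  "norm x = sqrt (x \<bullet> x)" for x :: quat
definition dist_quat :: "quat \<Rightarrow> quat \<Rightarrow> real" where
  "dist x y = norm (x - y)" for x y :: quat
definition sgn_quat :: "quat \<Rightarrow> quat" where
  "sgn x = x /\<^sub>R norm x" for x :: quat
definition uniformity_quat :: "(quat \<times> quat) filter" where
  "uniformity_quat = (INF e\<in>{0 <..}. principal {(x, y). dist x y < e})"
definition open_quat :: "quat set \<Rightarrow> bool" where
  "open_quat U \<longleftrightarrow> (\<forall>x\<in>U. eventually (\<lambda>(x', y). x' = x \<longrightarrow> y \<in> U) uniformity)"

instance
proof
  fix x y z :: quat and r :: real and U :: "quat set"
  show "dist x y = norm (x - y)" by (rule dist_quat_def)
  show "sgn x = x /\<^sub>R norm x" by (rule sgn_quat_def)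
  show "uniformity = (INF e\<in>{0 <..}. principal {(x :: quat, y). dist x y < e})"
    by (rule uniformity_quat_def)
  show "open U \<longleftrightarrow> (\<forall>x\<in>U. \<forall>\<^sub>F (x', y) in uniformity. x' = x \<longrightarrow> y \<in> U)"
    by (rule open_quat_def)
  show "x \<bullet> y = y \<bullet> x" by (simp add: inner_quat_def algebra_simps)
  show "(x + y) \<bullet> z = x \<bullet> z + y \<bullet> z" by (simp add: inner_quat_def algebra_simps)
  show "(r *\<^sub>R x) \<bullet> y = r * (x \<bullet> y)" by (simp add: inner_quat_def algebra_simps)
  show "0 \<le> x \<bullet> x" by (simp add: inner_quat_def)
  show "x \<bullet> x = 0 \<longleftrightarrow> x = 0"
    using quat_sum_squares_eq_0[of x] by (simp add: inner_quat_def power2_eq_square)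
  show "norm x = sqrt (x \<bullet> x)" by (rule norm_quat_def)
qed

end

instance quat :: real_normed_div_algebra
proof
  fix x y :: quat
  have "(x * y) \<bullet> (x * y) = (x \<bullet> x) * (y \<bullet> y)"
    unfolding inner_quat_def quat_times_sel by algebra
  then show "norm (x * y) = norm x * norm y"
    by (simp add: norm_quat_def real_sqrt_mult)
qed

definition quat_i :: quat where "quat_i = Quat 0 1 0 0"
definition quat_j :: quat where "quat_j = Quat 0 0 1 0"
definition quat_k :: quat where "quat_k = Quat 0 0 0 1"

instantiation quat :: euclidean_space
begin

definition Basis_quat :: "quat set" where "Basis = {1, quat_i, quat_j, quat_k}"

instance
proof
  show "finite (Basis :: quat set)" by (simp add: Basis_quat_def)
  show "(Basis :: quat set) \<noteq> {}" by (simp add: Basis_quat_def)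
  fix x y :: quat
  show "\<lbrakk>x \<in> Basis; y \<in> Basis\<rbrakk> \<Longrightarrow> x \<bullet> y = (if x = y then 1 else 0)"
    by (auto simp: Basis_quat_def inner_quat_def quat_i_def quat_j_def quat_k_def quat_eq_iff)
  show "(\<forall>y\<in>Basis. x \<bullet> y = 0) \<longleftrightarrow> x = 0"
    unfolding Basis_quat_def
    by (simp add: inner_quat_def quat_i_def quat_j_def quat_k_def quat_eq_iff[of x 0])
qed

end

definition quat_of_complex :: "complex \<Rightarrow> quat" where
  "quat_of_complex z = Quat (Re z) (Im z) 0 0"

text \<open>The copy of Euclidean 3-space inside the quaternions.\<close>

definition imag_quats :: "quat set" where "imag_quats = {x. q_re x = 0}"


section \<open>Theta functions\<close>

text \<open>With the nome \<open>exp (\<i> * pi * \<tau>)\<close>, not \<open>exp (2 * \<i> * pi * \<tau>)\<close>; powers of the nome are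
  fixed by \<open>\<tau>\<close> and involve no choice of branch.\<close>

definition nome_pow :: "complex \<Rightarrow> real \<Rightarrow> complex" where
  "nome_pow \<tau> c = exp (\<i> * of_real pi * \<tau> * of_real c)"

definition theta1 :: "complex \<Rightarrow> complex \<Rightarrow> complex" where
  "theta1 z \<tau> = 2 * (\<Sum>n. (-1) ^ n * nome_pow \<tau> ((real n + 1/2)\<^sup>2) * sin ((2 * of_nat n + 1) * z))"

definition theta2 :: "complex \<Rightarrow> complex \<Rightarrow> complex" where
  "theta2 z \<tau> = 2 * (\<Sum>n. nome_pow \<tau> ((real n + 1/2)\<^sup>2) * cos ((2 * of_nat n + 1) * z))"

definition dtheta1_0 :: "complex \<Rightarrow> complex" where
  "dtheta1_0 \<tau> = deriv (\<lambda>z. theta1 z \<tau>) 0"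


section \<open>The normal form\<close>

definition crit_R :: "complex \<Rightarrow> real \<Rightarrow> complex" where
  "crit_R \<tau> \<omega> = 2 * (theta2 (of_real \<omega>) \<tau>)\<^sup>2 / (dtheta1_0 \<tau> * theta1 (2 * of_real \<omega>) \<tau>)"

definition gamma_curve :: "complex \<Rightarrow> real \<Rightarrow> real \<Rightarrow> real \<Rightarrow> complex" where
  "gamma_curve \<tau> \<omega> u w =
     - \<i> * crit_R \<tau> \<omega> *
     (theta1 ((of_real u + \<i> * of_real w - 3 * of_real \<omega>) / 2) \<tau> /
      theta1 ((of_real u + \<i> * of_real w + of_real \<omega>) / 2) \<tau>)"

definition W1 :: "complex \<Rightarrow> real \<Rightarrow> real \<Rightarrow> complex" where
  "W1 \<tau> \<omega> w =
     \<i> * (dtheta1_0 \<tau> / (2 * theta2 (of_real \<omega>) \<tau>)) *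
     (theta2 (of_real \<omega> - \<i> * of_real w) \<tau> / theta1 (\<i> * of_real w) \<tau>)"

definition smooth_fun :: "(real \<Rightarrow> real) \<Rightarrow> bool" where
  "smooth_fun g \<longleftrightarrow> (\<forall>n. (deriv ^^ n) g differentiable_on UNIV)"

text \<open>The smooth, possibly sign changing, real square root \<open>s\<close> of \<open>1 - w'\<^sup>2\<close> is a choice and
  therefore a parameter.\<close>

definition tau_admissible :: "complex \<Rightarrow> (real \<Rightarrow> real) \<Rightarrow> (real \<Rightarrow> real) \<Rightarrow> bool" where
  "tau_admissible \<tau> w s \<longleftrightarrow>
     smooth_fun w \<and> (\<forall>v. 0 < w v \<and> w v < 2 * pi * Im \<tau>) \<and>
     smooth_fun s \<and> (\<forall>v. (s v)\<^sup>2 = 1 - (deriv w v)\<^sup>2)"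

definition normal_form ::
  "complex \<Rightarrow> real \<Rightarrow> (real \<Rightarrow> real) \<Rightarrow> (real \<Rightarrow> real) \<Rightarrow> (real \<Rightarrow> quat) \<Rightarrow> (real \<Rightarrow> real \<Rightarrow> quat) \<Rightarrow> bool"
  where
  "normal_form \<tau> \<omega> w s \<Phi> f \<longleftrightarrow>
     tau_admissible \<tau> w s \<and>
     (\<forall>v. \<Phi> v \<noteq> 0 \<and> \<Phi> differentiable (at v) \<and>
        vector_derivative \<Phi> (at v) * inverse (\<Phi> v) =
          quat_of_complex (of_real (s v) * W1 \<tau> \<omega> (w v)) * quat_k) \<and>
     (\<forall>u v. f u v =
        inverse (\<Phi> v) * quat_of_complex (gamma_curve \<tau> \<omega> u (w v)) * quat_j * \<Phi> v)"


section \<open>Geometry of parametrized surfaces\<close>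

definition pd_u :: "(real \<Rightarrow> real \<Rightarrow> quat) \<Rightarrow> real \<Rightarrow> real \<Rightarrow> quat" where
  "pd_u f u v = vector_derivative (\<lambda>x. f x v) (at u)"

definition pd_v :: "(real \<Rightarrow> real \<Rightarrow> quat) \<Rightarrow> real \<Rightarrow> real \<Rightarrow> quat" where
  "pd_v f u v = vector_derivative (\<lambda>y. f u y) (at v)"

definition surface_points :: "(real \<Rightarrow> real \<Rightarrow> quat) \<Rightarrow> quat set" where
  "surface_points f = range (\<lambda>(u, v). f u v)"

text \<open>For a planar \<open>u\<close>-curve that is not contained in a line this is the plane of the curve.\<close>

definition u_plane :: "(real \<Rightarrow> real \<Rightarrow> quat) \<Rightarrow> real \<Rightarrow> quat set" where
  "u_plane f v = affine hull (range (\<lambda>u. f u v))"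

definition generic_u_planes :: "(real \<Rightarrow> real \<Rightarrow> quat) \<Rightarrow> bool" where
  "generic_u_planes f \<longleftrightarrow>
     span {n \<in> imag_quats. \<exists>v. \<forall>x \<in> u_plane f v. \<forall>y \<in> u_plane f v. n \<bullet> (x - y) = 0} = imag_quats"

definition sphere_inversion :: "real \<Rightarrow> quat \<Rightarrow> quat" where
  "sphere_inversion R x = (R\<^sup>2 / (norm x)\<^sup>2) *\<^sub>R x"

definition christoffel_dual :: "(real \<Rightarrow> real \<Rightarrow> quat) \<Rightarrow> (real \<Rightarrow> real \<Rightarrow> quat) \<Rightarrow> bool" where
  "christoffel_dual f g \<longleftrightarrow>
     (\<forall>u v.
        (\<lambda>x. f x v) differentiable (at u) \<and> (\<lambda>y. f u y) differentiable (at v) \<and>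
        (\<lambda>x. g x v) differentiable (at u) \<and> (\<lambda>y. g u y) differentiable (at v) \<and>
        pd_u f u v \<noteq> 0 \<and> pd_v f u v \<noteq> 0 \<and>
        pd_u g u v = pd_u f u v /\<^sub>R (norm (pd_u f u v))\<^sup>2 \<and>
        pd_v g u v = - (pd_v f u v /\<^sub>R (norm (pd_v f u v))\<^sup>2))"

end

(* Both theta functions are the even function theta2 up to a quarter-period shift. Splitting the
   double sum theta2(x + y) theta2(x - y) by parity separates the variables, so that
   theta1(x + y) theta1(x - y) becomes a 2x2 determinant and Weierstrass' three-term relation
   becomes a Pluecker relation. Two instances of it do the geometry: differentiated at the
   critical omega it says that gamma_u is -i times the square of a quotient of theta functions, and
   for the potential W1 it gives 2 Re(gamma conj W1) = |gamma_u|, which makes f conformal.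
   For Re tau = 1/2 the theta functions are real up to the constant phase exp(i pi/8), so the
   inversion and the Christoffel dual reduce to oddness and quarter-period shifts. All divisors
   are nonzero by the Jacobi triple product, obtained as a limit of its finite form. *)

theory Submission
  imports Defs "HOL-Complex_Analysis.Complex_Analysis"
begin

text \<open>\<open>gamma_curve\<close> sees \<open>u\<close> and \<open>w\<close> only through z = u
  + i w, so one holomorphic function \<open>gamma_ext\<close> carries both partial derivatives. The
  thetas are evaluated at half arguments, so 0 < w < 2 pi Im \<tau> is exactly a strip free of
  zeros. Only the divisor theta1(i w) of \<open>W1\<close> leaves that strip; there Re \<tau> = 1/2
  is used a second time, because it makes the squared nome negative.

  The identity for Re(gamma conj W1) is not holomorphic as it stands. It becomes so because
  conjugation acts on a theta value as a constant phase and on its argument as the translation by -i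
  Im z.

  Differentiating the conjugation by \<open>\<Phi>\<close> produces a commutator of g j with a k,
  which is normal to the plane of the u-curve. Hence f_v has in-plane part of length |w'| |gamma'|
  and normal part of length |s| |gamma'|, and w'^2 + s^2 = 1 gives |f_v| = |f_u|. Conjugation also
  fixes the origin, so every plane of a u-curve is a linear subspace; this is why inversion about
  the origin and negation preserve it.\<close>

lemma has_sum_Times_mult:
  fixes f :: "'a \<Rightarrow> 'c::{real_normed_div_algebra,banach}" and g :: "'b \<Rightarrow> 'c"
  assumes f: "(\<lambda>x. norm (f x)) summable_on A" and g: "(\<lambda>x. norm (g x)) summable_on B"
    and fa: "(f has_sum a) A" and gb: "(g has_sum b) B"
  shows "((\<lambda>(x, y). f x * g y) has_sum a * b) (A \<times> B)"
proof (rule has_sum_SigmaI)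
  show "((\<lambda>y. case (x, y) of (x, y) \<Rightarrow> f x * g y) has_sum f x * b) B" for x
    using has_sum_cmult_right[OF gb] by simp
  show "((\<lambda>x. f x * b) has_sum a * b) A"
    using has_sum_cmult_left[OF fa] .
  have "(\<lambda>p. norm ((\<lambda>(x, y). f x * g y) p)) summable_on A \<times> B"
    unfolding Infinite_Sum.abs_summable_on_Sigma_iff
    using g f by (auto simp: norm_mult infsum_cmult_right infsum_nonneg abs_mult
        intro!: summable_on_cmult_right summable_on_cmult_left)
  then show "(\<lambda>(x, y). f x * g y) summable_on A \<times> B"
    by (rule abs_summable_summable)
qed

text \<open>The quadratic relation between the six minors of the 2x4 matrix with columns (a, a'),
  (b, b'), (c, c'), (d, d').\<close>

lemma pluecker_relation:
  fixes a b c d a' b' c' d' :: complex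
  shows "(a * b' - a' * b) * (c * d' - c' * d) - (a * c' - a' * c) * (b * d' - b' * d)
    + (a * d' - a' * d) * (b * c' - b' * c) = 0"
  by algebra

section \<open>Theta functions as sums over the integers\<close>

text \<open>The general term of a theta series with a real index \<open>x\<close>: integers and
  half-integers are then the same function, and reindexing only moves \<open>x\<close>.\<close>

definition gauss_exp :: "complex \<Rightarrow> real \<Rightarrow> complex \<Rightarrow> complex" where
  "gauss_exp \<tau> x z = exp (\<i> * of_real pi * \<tau> * of_real (x\<^sup>2) + 2 * \<i> * of_real x * z)"

text \<open>Completing the square with |b| + 1 in place of |b|: the extra 1 leaves -|x|, which makes
  the theta terms summable by comparison with a geometric series.\<close>

lemma quadratic_exponent_le:
  fixes a b x :: real
  assumes "a > 0"
  shows "- a * x\<^sup>2 + b * x \<le> - \<bar>x\<bar> + (\<bar>b\<bar> + 1)\<^sup>2 / (4 * a)"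
proof -
  have "0 \<le> a * (\<bar>x\<bar> - (\<bar>b\<bar> + 1) / (2 * a))\<^sup>2" using assms by simp
  also have "\<dots> = a * x\<^sup>2 - (\<bar>b\<bar> + 1) * \<bar>x\<bar> + (\<bar>b\<bar> + 1)\<^sup>2 / (4 * a)"
    using assms by (simp add: field_simps power2_eq_square)
  finally show ?thesis
    using abs_ge_self[of "b * x"] by (simp add: abs_mult algebra_simps)
qed

lemma summable_on_int_exp_minus_abs:
  fixes c :: real
  shows "(\<lambda>n::int. exp (- \<bar>of_int n + c\<bar>)) summable_on UNIV"
proof -
  have nat: "(\<lambda>n::nat. exp (- real n)) summable_on UNIV"
    using summable_geometric[of "exp (-1::real)"]
    by (subst summable_on_UNIV_nonneg_real_iff) (auto simp: exp_of_nat_mult[symmetric])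
  have pos: "(\<lambda>n::int. exp (- \<bar>of_int n\<bar> :: real)) summable_on range int"
    using nat by (subst summable_on_reindex) (auto simp: o_def)
  have neg: "(\<lambda>n::int. exp (- \<bar>of_int n\<bar> :: real)) summable_on range (\<lambda>n. - int n)"
    using nat by (subst summable_on_reindex) (auto simp: o_def inj_on_def)
  have "UNIV = range int \<union> range (\<lambda>n. - int n)"
  proof (intro set_eqI iffI UnCI)
    fix x :: int assume "x \<notin> range (\<lambda>n. - int n)"
    then show "x \<in> range int" by (metis int_cases2 rangeI)
  qed simp
  then have "(\<lambda>n::int. exp (- \<bar>of_int n\<bar> :: real)) summable_on UNIV"
    using summable_on_union[OF pos neg] by simp
  then have "(\<lambda>n::int. exp \<bar>c\<bar> * exp (- \<bar>of_int n\<bar> :: real)) summable_on UNIV"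
    by (rule summable_on_cmult_right)
  then have "(\<lambda>n::int. norm (exp (- \<bar>of_int n + c\<bar>))) summable_on UNIV"
    by (rule Infinite_Sum.abs_summable_on_comparison_test') (auto simp flip: exp_add)
  then show ?thesis by simp
qed

lemma norm_gauss_exp:
  "norm (gauss_exp \<tau> x z) = exp (- (pi * Im \<tau>) * x\<^sup>2 + (- 2 * Im z) * x)"
  by (simp add: gauss_exp_def field_simps)

lemma gauss_exp_abs_summable:
  assumes "Im \<tau> > 0"
  shows "(\<lambda>n::int. norm (gauss_exp \<tau> (of_int n + c) z)) summable_on UNIV"
proof -
  define K where "K = (\<bar>- 2 * Im z\<bar> + 1)\<^sup>2 / (4 * (pi * Im \<tau>))"
  have "(\<lambda>n::int. exp K * exp (- \<bar>of_int n + c\<bar>)) summable_on UNIV"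
    by (intro summable_on_cmult_right summable_on_int_exp_minus_abs)
  then show ?thesis
  proof (rule Infinite_Sum.abs_summable_on_comparison_test')
    fix n :: int
    have "- (pi * Im \<tau>) * (of_int n + c)\<^sup>2 + (- 2 * Im z) * (of_int n + c) \<le> K + - \<bar>of_int n + c\<bar>"
      using quadratic_exponent_le[of "pi * Im \<tau>" "of_int n + c" "- 2 * Im z"] assms
      by (simp add: K_def)
    then show "norm (gauss_exp \<tau> (of_int n + c) z) \<le> exp K * exp (- \<bar>of_int n + c\<bar>)"
      by (simp only: norm_gauss_exp flip: exp_add) simp
  qed
qed

lemma gauss_exp_summable:
  assumes "Im \<tau> > 0"
  shows "(\<lambda>n::int. gauss_exp \<tau> (of_int n + c) z) summable_on UNIV"
  by (rule abs_summable_summable[OF gauss_exp_abs_summable[OF assms]])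

text \<open>Classically \<open>\<vartheta>\<^sub>3(2z | 2\<tau>)\<close> and \<open>\<vartheta>\<^sub>2(2z | 2\<tau>)\<close>.\<close>

definition theta_even :: "complex \<Rightarrow> complex \<Rightarrow> complex" where
  "theta_even \<tau> z = (\<Sum>\<^sub>\<infinity>n::int. gauss_exp (2 * \<tau>) (of_int n) (2 * z))"

definition theta_odd :: "complex \<Rightarrow> complex \<Rightarrow> complex" where
  "theta_odd \<tau> z = (\<Sum>\<^sub>\<infinity>n::int. gauss_exp (2 * \<tau>) (of_int n + 1/2) (2 * z))"

context
  fixes \<tau> :: complex
  assumes Im_tau: "Im \<tau> > 0"
begin

text \<open>The indices n + 1/2 and -(n + 1/2) carry the same power of the nome, so pairing
  \<open>n\<close> with \<open>- n - 1\<close> folds exponentials into cosines. The two-sided series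
  is the one to reindex; the one-sided series serves termwise conjugation, uniform convergence and
  the product formula.\<close>

lemma
  shows theta2_has_sum: "((\<lambda>n::int. gauss_exp \<tau> (of_int n + 1/2) z) has_sum theta2 z \<tau>) UNIV"
    and theta2_sums: "(\<lambda>n::nat. 2 * (nome_pow \<tau> ((real n + 1/2)\<^sup>2) * cos ((2 * of_nat n + 1) * z))) sums theta2 z \<tau>"
proof -
  define g where "g = (\<lambda>n::int. gauss_exp \<tau> (of_int n + 1/2) z)"
  have g: "g summable_on UNIV" unfolding g_def by (rule gauss_exp_summable[OF Im_tau])
  have gp: "g summable_on range int" and gn: "g summable_on range (\<lambda>n. - int n - 1)"
    by (rule summable_on_subset_banach[OF g], simp)+
  have "range int \<union> range (\<lambda>n. - int n - 1) = UNIV"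
  proof (intro set_eqI iffI UnCI UNIV_I)
    fix x :: int assume "x \<notin> range (\<lambda>n. - int n - 1)"
    moreover have "x = - int (nat (- x - 1)) - 1" if "x < 0" using that by simp
    ultimately have "x \<ge> 0" by (metis not_le rangeI)
    then show "x \<in> range int" by (metis nonneg_int_cases rangeI)
  qed
  moreover have "range int \<inter> range (\<lambda>n. - int n - 1) = {}" by auto
  ultimately have split: "infsum g UNIV = infsum g (range int) + infsum g (range (\<lambda>n. - int n - 1))"
    using infsum_Un_disjoint[OF gp gn] by simp
  have hp: "((\<lambda>n::nat. g (int n)) has_sum infsum g (range int)) UNIV"
    using has_sum_infsum[OF gp] by (subst (asm) has_sum_reindex) (auto simp: o_def)
  have hn: "((\<lambda>n::nat. g (- int n - 1)) has_sum infsum g (range (\<lambda>n. - int n - 1))) UNIV"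
    using has_sum_infsum[OF gn] by (subst (asm) has_sum_reindex) (auto simp: o_def inj_on_def)
  have "(\<lambda>n::nat. g (int n) + g (- int n - 1)) sums infsum g UNIV"
    unfolding split by (rule sums_add[OF has_sum_imp_sums[OF hp] has_sum_imp_sums[OF hn]])
  moreover have "g (int n) + g (- int n - 1) =
      2 * (nome_pow \<tau> ((real n + 1/2)\<^sup>2) * cos ((2 * of_nat n + 1) * z))" for n
  proof -
    have sq: "(- (1 / 2) - real n)\<^sup>2 = (real n + 1 / 2)\<^sup>2" by (simp add: power2_eq_square field_simps)
    have e: "gauss_exp \<tau> x z = nome_pow \<tau> (x\<^sup>2) * exp (2 * \<i> * of_real x * z)" for x
      by (simp add: gauss_exp_def nome_pow_def exp_add)
    have 1: "g (int n) = nome_pow \<tau> ((real n + 1/2)\<^sup>2) * exp (\<i> * ((2 * of_nat n + 1) * z))"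
      unfolding g_def e by (simp add: algebra_simps)
    have 2: "g (- int n - 1) = nome_pow \<tau> ((real n + 1/2)\<^sup>2) * exp (- (\<i> * ((2 * of_nat n + 1) * z)))"
      unfolding g_def e by (simp add: sq) (simp add: algebra_simps)
    show ?thesis
      unfolding 1 2 cos_exp_eq by (simp add: field_simps)
  qed
  ultimately have *: "(\<lambda>n::nat. 2 * (nome_pow \<tau> ((real n + 1/2)\<^sup>2) * cos ((2 * of_nat n + 1) * z))) sums infsum g UNIV"
    by simp
  then have "(\<lambda>n::nat. nome_pow \<tau> ((real n + 1/2)\<^sup>2) * cos ((2 * of_nat n + 1) * z)) sums (infsum g UNIV / 2)"
    using sums_divide[OF *, of 2] by simp
  then have eq: "theta2 z \<tau> = infsum g UNIV"
    unfolding theta2_def by (simp flip: sums_unique)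
  then show "((\<lambda>n::int. gauss_exp \<tau> (of_int n + 1/2) z) has_sum theta2 z \<tau>) UNIV"
    using g by (simp add: g_def summable_iff_has_sum_infsum)
  show "(\<lambda>n::nat. 2 * (nome_pow \<tau> ((real n + 1/2)\<^sup>2) * cos ((2 * of_nat n + 1) * z))) sums theta2 z \<tau>"
    using * eq by simp
qed

section \<open>Quarter-period shifts, parity, conjugation and holomorphy of the theta
  functions\<close>

lemma cos_odd_mult_shift:
  "cos ((2 * of_nat n + 1) * (z - of_real pi / 2)) = (-1) ^ n * sin ((2 * of_nat n + 1) * z)" for z :: complex
proof -
  have "(2 * of_nat n + 1) * (z - of_real pi / 2) = (2 * of_nat n + 1) * z - of_real pi / 2 - of_nat n * of_real pi"
    by (simp add: field_simps)
  also have "cos \<dots> = cos ((2 * of_nat n + 1) * z - of_real pi / 2) * cos (of_nat n * of_real pi)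
     + sin ((2 * of_nat n + 1) * z - of_real pi / 2) * sin (of_nat n * of_real pi)"
    by (rule cos_diff)
  also have "cos (of_nat n * of_real pi :: complex) = of_real (cos (real n * pi))"
    by (simp flip: cos_of_real)
  also have "sin (of_nat n * of_real pi :: complex) = of_real (sin (real n * pi))"
    by (simp flip: sin_of_real)
  finally show ?thesis
    by (simp add: cos_diff)
qed

lemma theta1_eq_theta2_shift: "theta1 z \<tau> = theta2 (z - of_real pi / 2) \<tau>"
  by (simp add: theta1_def theta2_def cos_odd_mult_shift mult.left_commute mult.assoc)

lemma theta1_sums:
  "(\<lambda>n::nat. 2 * ((-1) ^ n * nome_pow \<tau> ((real n + 1/2)\<^sup>2) * sin ((2 * of_nat n + 1) * z))) sums theta1 z \<tau>"
  using theta2_sums[of "z - of_real pi / 2"]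
  by (simp add: theta1_eq_theta2_shift cos_odd_mult_shift mult.left_commute mult.assoc)

lemma theta1_minus [simp]: "theta1 (- z) \<tau> = - theta1 z \<tau>"
  using sums_unique2[OF theta1_sums[of "-z"]] sums_minus[OF theta1_sums[of z]] by simp

lemma theta2_minus [simp]: "theta2 (- z) \<tau> = theta2 z \<tau>"
  by (simp add: theta2_def)

lemma theta1_0 [simp]: "theta1 0 \<tau> = 0"
  by (simp add: theta1_def)

lemma theta1_add_pi_half: "theta1 (z + of_real pi / 2) \<tau> = theta2 z \<tau>"
  by (simp add: theta1_eq_theta2_shift)

lemma theta2_add_pi_half: "theta2 (z + of_real pi / 2) \<tau> = - theta1 z \<tau>"
proof -
  have "theta2 (z + of_real pi / 2) \<tau> = theta2 (- (- z - of_real pi / 2)) \<tau>"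
    by (simp add: add.commute)
  also have "\<dots> = theta1 (- z) \<tau>" by (simp only: theta2_minus theta1_eq_theta2_shift)
  finally show ?thesis by simp
qed

lemma theta1_add_pi: "theta1 (z + of_real pi) \<tau> = - theta1 z \<tau>"
  using theta1_add_pi_half[of "z + of_real pi / 2"] theta2_add_pi_half[of z]
  by (simp add: add.assoc)

text \<open>Since n(n+1) is even, (n + 1/2)^2 is 1/4 modulo 2. Conjugation multiplies the term by
  exp(-i pi (n + 1/2)^2), so the factor does not depend on \<open>n\<close> and passes to the whole
  series.\<close>

lemma cnj_nome_pow:
  assumes "Re \<tau> = 1/2"
  shows "cnj (nome_pow \<tau> ((real n + 1/2)\<^sup>2)) = exp (- (\<i> * of_real pi / 4)) * nome_pow \<tau> ((real n + 1/2)\<^sup>2)"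
proof -
  have "even (n * (n + 1))" by simp
  then obtain k where k: "n * (n + 1) = 2 * k" by blast
  have sq: "(real n + 1/2)\<^sup>2 = 2 * real k + 1/4"
    using arg_cong[OF k, of real] by (simp add: power2_eq_square algebra_simps)
  have "cnj (\<i> * of_real pi * \<tau> * of_real (2 * real k + 1/4)) =
     (- (\<i> * of_real pi / 4) + \<i> * of_real pi * \<tau> * of_real (2 * real k + 1/4)) - of_nat k * (2 * of_real pi * \<i>)"
    by (simp add: complex_eq_iff assms algebra_simps)
  moreover have "exp (of_nat k * (2 * of_real pi * \<i>)) = 1"
    by (simp add: exp_of_nat_mult)
  ultimately show ?thesis
    unfolding nome_pow_def sq exp_cnj exp_add[symmetric] by (simp only: exp_diff) simp
qed

lemma cnj_theta2:
  assumes "Re \<tau> = 1/2"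
  shows "cnj (theta2 z \<tau>) = exp (- (\<i> * of_real pi / 4)) * theta2 (cnj z) \<tau>"
proof -
  have "(\<lambda>n. cnj (2 * (nome_pow \<tau> ((real n + 1/2)\<^sup>2) * cos ((2 * of_nat n + 1) * z)))) sums cnj (theta2 z \<tau>)"
    by (subst sums_cnj) (rule theta2_sums)
  then have "(\<lambda>n. exp (- (\<i> * of_real pi / 4)) * (2 * (nome_pow \<tau> ((real n + 1/2)\<^sup>2) * cos ((2 * of_nat n + 1) * cnj z)))) sums cnj (theta2 z \<tau>)"
    by (simp add: cnj_nome_pow[OF assms] cnj_cos mult_ac)
  with sums_mult[OF theta2_sums] show ?thesis by (rule sums_unique2[symmetric])
qed

lemma cnj_theta1:
  assumes "Re \<tau> = 1/2"
  shows "cnj (theta1 z \<tau>) = exp (- (\<i> * of_real pi / 4)) * theta1 (cnj z) \<tau>"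
  by (simp add: theta1_eq_theta2_shift cnj_theta2[OF assms])

text \<open>From |cos a| <= exp |a|: on the disc of radius \<open>B\<close> the worst case is
  attained by the exponential series at the imaginary point -i B, whose absolute summability is
  already known.\<close>

lemma theta2_majorant:
  assumes "B \<ge> 0"
  defines "M \<equiv> \<lambda>n::nat. 2 * norm (gauss_exp \<tau> (of_int (int n) + 1/2) (- \<i> * of_real B))"
  shows "summable M"
    and "norm y \<le> B \<Longrightarrow> norm (2 * (nome_pow \<tau> ((real n + 1/2)\<^sup>2) * cos ((2 * of_nat n + 1) * y))) \<le> M n"
proof -
  have "(\<lambda>n::int. norm (gauss_exp \<tau> (of_int n + 1/2) (- \<i> * of_real B))) summable_on range int"
    using gauss_exp_abs_summable[OF Im_tau] by (rule summable_on_subset_banach) simp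
  then have "(\<lambda>n::nat. norm (gauss_exp \<tau> (of_int (int n) + 1/2) (- \<i> * of_real B))) summable_on UNIV"
    by (subst (asm) summable_on_reindex) (auto simp: o_def)
  then show "summable M"
    unfolding M_def by (intro summable_mult summable_on_imp_summable)
  assume y: "norm y \<le> B"
  then have "norm ((2 * of_nat n + 1) * y) \<le> (2 * real n + 1) * B"
    unfolding norm_mult by (intro mult_mono) (auto intro: order_trans[OF norm_triangle_ineq] simp: norm_mult)
  then have "norm (cos ((2 * of_nat n + 1) * y)) \<le> exp ((2 * real n + 1) * B)"
    by (intro order_trans[OF norm_cos_le]) simp
  moreover have "norm (nome_pow \<tau> ((real n + 1/2)\<^sup>2)) * exp ((2 * real n + 1) * B) =
      norm (gauss_exp \<tau> (of_int (int n) + 1/2) (- \<i> * of_real B))"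
    unfolding norm_gauss_exp by (simp add: nome_pow_def algebra_simps flip: exp_add)
  ultimately show "norm (2 * (nome_pow \<tau> ((real n + 1/2)\<^sup>2) * cos ((2 * of_nat n + 1) * y))) \<le> M n"
    unfolding M_def norm_mult
    by (metis mult_left_mono norm_ge_zero norm_numeral)
qed

lemma theta1_abs_summable:
  "summable (\<lambda>n::nat. norm (2 * ((-1) ^ n * nome_pow \<tau> ((real n + 1/2)\<^sup>2) * sin ((2 * of_nat n + 1) * z))))"
proof -
  have "summable (\<lambda>n. norm (2 * (nome_pow \<tau> ((real n + 1/2)\<^sup>2) * cos ((2 * of_nat n + 1) * (z - of_real pi / 2)))))"
    by (rule summable_comparison_test'[OF theta2_majorant(1)[of "norm (z - of_real pi / 2)"], of 0])
      (use theta2_majorant(2)[OF norm_ge_zero order_refl] in auto)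
  then show ?thesis
    by (simp add: cos_odd_mult_shift mult.left_commute mult.assoc)
qed

lemma theta2_holomorphic: "(\<lambda>z. theta2 z \<tau>) holomorphic_on UNIV"
proof (rule holomorphic_uniform_sequence)
  define a where "a = (\<lambda>n::nat. \<lambda>z. 2 * (nome_pow \<tau> ((real n + 1/2)\<^sup>2) * cos ((2 * of_nat n + 1) * z)))"
  show "(\<lambda>z. \<Sum>n<N. a n z) holomorphic_on UNIV" for N
    unfolding a_def by (intro holomorphic_intros)
  fix z :: complex
  have B: "norm z + 1 \<ge> 0" by simp
  have "uniform_limit (cball z 1) (\<lambda>N y. \<Sum>n<N. a n y) (\<lambda>y. \<Sum>n. a n y) sequentially"
  proof (rule Weierstrass_m_test[OF _ theta2_majorant(1)[OF B]])
    fix n y assume "y \<in> cball z 1"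
    then have "norm y \<le> norm z + 1"
      using norm_triangle_ineq2[of y z] by (simp add: dist_norm norm_minus_commute)
    then show "norm (a n y) \<le> 2 * norm (gauss_exp \<tau> (of_int (int n) + 1/2) (- \<i> * of_real (norm z + 1)))"
      unfolding a_def by (rule theta2_majorant(2)[OF B])
  qed
  moreover have "(\<Sum>n. a n y) = theta2 y \<tau>" for y
    using theta2_sums[of y] by (simp add: a_def sums_iff)
  ultimately show "\<exists>d>0. cball z d \<subseteq> UNIV \<and> uniform_limit (cball z d) (\<lambda>N y. \<Sum>n<N. a n y) (\<lambda>y. theta2 y \<tau>) sequentially"
    by (intro exI[of _ 1]) auto
qed simp

lemma theta1_holomorphic: "(\<lambda>z. theta1 z \<tau>) holomorphic_on UNIV"
proof -
  have "(\<lambda>z. theta2 z \<tau>) \<circ> (\<lambda>z. z - of_real pi / 2) holomorphic_on UNIV"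
    by (intro holomorphic_on_compose_gen[OF _ theta2_holomorphic] holomorphic_intros) auto
  then show ?thesis by (simp add: o_def flip: theta1_eq_theta2_shift)
qed

lemma theta1_has_field_derivative [derivative_intros]:
  assumes "(g has_field_derivative g') (at z within S)"
  shows "((\<lambda>z. theta1 (g z) \<tau>) has_field_derivative deriv (\<lambda>z. theta1 z \<tau>) (g z) * g') (at z within S)"
  by (rule DERIV_chain2[OF holomorphic_derivI[OF theta1_holomorphic] assms]) auto

lemma theta2_has_field_derivative [derivative_intros]:
  assumes "(g has_field_derivative g') (at z within S)"
  shows "((\<lambda>z. theta2 (g z) \<tau>) has_field_derivative deriv (\<lambda>z. theta2 z \<tau>) (g z) * g') (at z within S)"
  by (rule DERIV_chain2[OF holomorphic_derivI[OF theta2_holomorphic] assms]) auto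

section \<open>The three-term relation\<close>

lemma theta_even_has_sum:
  "((\<lambda>n::int. gauss_exp (2 * \<tau>) (of_int n) (2 * z)) has_sum theta_even \<tau> z) UNIV"
  using gauss_exp_summable[of "2 * \<tau>" 0 "2 * z"] Im_tau
  by (simp add: theta_even_def has_sum_infsum)

lemma theta_odd_has_sum:
  "((\<lambda>n::int. gauss_exp (2 * \<tau>) (of_int n + 1/2) (2 * z)) has_sum theta_odd \<tau> z) UNIV"
  using gauss_exp_summable[of "2 * \<tau>" "1/2" "2 * z"] Im_tau
  by (simp add: theta_odd_def has_sum_infsum)

text \<open>The parallelogram identity a^2 + b^2 = 2 ((a+b)/2)^2 + 2 ((a-b)/2)^2; its factor 2 is
  the origin of the doubled period in \<open>theta_even\<close> and
  \<open>theta_odd\<close>.\<close>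

lemma gauss_exp_mult:
  "gauss_exp \<tau> a (x + y) * gauss_exp \<tau> b (x - y) =
   gauss_exp (2 * \<tau>) ((a + b) / 2) (2 * x) * gauss_exp (2 * \<tau>) ((a - b) / 2) (2 * y)"
proof -
  have "a\<^sup>2 + b\<^sup>2 = 2 * ((a + b) / 2)\<^sup>2 + 2 * ((a - b) / 2)\<^sup>2"
    by (simp add: power2_eq_square field_simps)
  from arg_cong[OF this, of complex_of_real]
  have *: "complex_of_real (a\<^sup>2) + of_real (b\<^sup>2) = 2 * of_real (((a + b) / 2)\<^sup>2) + 2 * of_real (((a - b) / 2)\<^sup>2)"
    by simp
  have "\<i> * of_real pi * \<tau> * of_real (a\<^sup>2) + 2 * \<i> * of_real a * (x + y) +
     (\<i> * of_real pi * \<tau> * of_real (b\<^sup>2) + 2 * \<i> * of_real b * (x - y)) =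
     \<i> * of_real pi * \<tau> * (of_real (a\<^sup>2) + of_real (b\<^sup>2)) + 2 * \<i> * of_real (a + b) * x + 2 * \<i> * of_real (a - b) * y"
    by (simp add: algebra_simps)
  also have "\<dots> = \<i> * of_real pi * (2 * \<tau>) * of_real (((a + b) / 2)\<^sup>2) + 2 * \<i> * of_real ((a + b) / 2) * (2 * x) +
     (\<i> * of_real pi * (2 * \<tau>) * of_real (((a - b) / 2)\<^sup>2) + 2 * \<i> * of_real ((a - b) / 2) * (2 * y))"
    unfolding * by (simp add: algebra_simps add_divide_distrib diff_divide_distrib)
  finally show ?thesis
    unfolding gauss_exp_def exp_add[symmetric] by simp
qed

text \<open>Splitting the double sum over \<open>(m, n)\<close> by the parity of \<open>m + n + 1\<close>, with new indices
  \<open>m + n + 1\<close> and \<open>m - n\<close>, separates the variables.\<close>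

lemma theta2_mult:
  "theta2 (x + y) \<tau> * theta2 (x - y) \<tau> = theta_even \<tau> x * theta_odd \<tau> y + theta_odd \<tau> x * theta_even \<tau> y"
proof -
  define h where "h = (\<lambda>(m::int, n::int). gauss_exp \<tau> (of_int m + 1/2) (x + y) * gauss_exp \<tau> (of_int n + 1/2) (x - y))"
  \<comment> \<open>On \<open>T\<close> half the sum of the two indices m + 1/2 and n + 1/2 is an
    integer and half their difference a half-integer; off \<open>T\<close> it is the other way
    round. This decides which variable goes into \<open>theta_even\<close>.\<close>
  define T where "T = {(m::int, n::int). odd (m + n)}"
  have total: "(h has_sum theta2 (x + y) \<tau> * theta2 (x - y) \<tau>) UNIV"
    using has_sum_Times_mult[OF gauss_exp_abs_summable gauss_exp_abs_summable theta2_has_sum theta2_has_sum] Im_tau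
    by (simp add: h_def)
  have I2: "Im (2 * \<tau>) > 0" using Im_tau by simp
  note e = gauss_exp_abs_summable[OF I2, of 0, simplified]
  have 1: "((\<lambda>(k, l). gauss_exp (2 * \<tau>) (of_int k) (2 * x) * gauss_exp (2 * \<tau>) (of_int l + 1/2) (2 * y))
      has_sum theta_even \<tau> x * theta_odd \<tau> y) (UNIV \<times> UNIV)"
    by (rule has_sum_Times_mult[OF e gauss_exp_abs_summable[OF I2] theta_even_has_sum theta_odd_has_sum])
  have 2: "((\<lambda>(k, l). gauss_exp (2 * \<tau>) (of_int k + 1/2) (2 * x) * gauss_exp (2 * \<tau>) (of_int l) (2 * y))
      has_sum theta_odd \<tau> x * theta_even \<tau> y) (UNIV \<times> UNIV)"
    by (rule has_sum_Times_mult[OF gauss_exp_abs_summable[OF I2] e theta_odd_has_sum theta_even_has_sum])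
  have 3: "(h has_sum theta_even \<tau> x * theta_odd \<tau> y) T"
  proof (subst has_sum_reindex_bij_witness[of T "\<lambda>(k, l). (k + l, k - l - 1)"
        "\<lambda>(m, n). ((m + n + 1) div 2, (m - n - 1) div 2)" "UNIV \<times> UNIV"
        "\<lambda>(k, l). gauss_exp (2 * \<tau>) (of_int k) (2 * x) * gauss_exp (2 * \<tau>) (of_int l + 1/2) (2 * y)" h, OF _ _ _ _ _ refl])
    fix p assume "p \<in> T"
    then obtain m n where p: "p = (m, n)" "odd (m + n)" by (auto simp: T_def)
    then obtain k' where "m + n = 2 * k' + 1" by (meson oddE)
    then have "m = (k' + 1) + (k' - n)" "n = (k' + 1) - (k' - n) - 1" by simp_all
    then obtain k l where mn: "m = k + l" "n = k - l - 1" by blast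
    have kl: "(m + n + 1) div 2 = k" "(m - n - 1) div 2 = l"
      by (simp_all add: mn)
    show "(case case p of (m, n) \<Rightarrow> ((m + n + 1) div 2, (m - n - 1) div 2) of (k, l) \<Rightarrow> (k + l, k - l - 1)) = p"
      unfolding p prod.case kl by (simp add: mn)
    have e: "(of_int m + 1/2 + (of_int n + 1/2)) / 2 = real_of_int k" "(of_int m + 1/2 - (of_int n + 1/2)) / 2 = real_of_int l + 1/2"
      by (simp_all add: mn field_simps)
    show "(case case p of (m, n) \<Rightarrow> ((m + n + 1) div 2, (m - n - 1) div 2) of
        (k, l) \<Rightarrow> gauss_exp (2 * \<tau>) (of_int k) (2 * x) * gauss_exp (2 * \<tau>) (of_int l + 1/2) (2 * y)) = h p"
      unfolding p prod.case kl h_def gauss_exp_mult by (simp only: e)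
  qed (use 1 in \<open>auto simp: T_def\<close>)
  have 4: "(h has_sum theta_odd \<tau> x * theta_even \<tau> y) (- T)"
  proof (subst has_sum_reindex_bij_witness[of "- T" "\<lambda>(k, l). (k + l, k - l)"
        "\<lambda>(m, n). ((m + n) div 2, (m - n) div 2)" "UNIV \<times> UNIV"
        "\<lambda>(k, l). gauss_exp (2 * \<tau>) (of_int k + 1/2) (2 * x) * gauss_exp (2 * \<tau>) (of_int l) (2 * y)" h, OF _ _ _ _ _ refl])
    fix p assume "p \<in> - T"
    then obtain m n where p: "p = (m, n)" "even (m + n)" by (cases p) (auto simp: T_def)
    then obtain k' where "m + n = 2 * k'" by (meson evenE)
    then have "m = k' + (k' - n)" "n = k' - (k' - n)" by simp_all
    then obtain k l where mn: "m = k + l" "n = k - l" by blast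
    have kl: "(m + n) div 2 = k" "(m - n) div 2 = l"
      by (simp_all add: mn)
    show "(case case p of (m, n) \<Rightarrow> ((m + n) div 2, (m - n) div 2) of (k, l) \<Rightarrow> (k + l, k - l)) = p"
      unfolding p prod.case kl by (simp add: mn)
    have e: "(of_int m + 1/2 + (of_int n + 1/2)) / 2 = real_of_int k + 1/2" "(of_int m + 1/2 - (of_int n + 1/2)) / 2 = real_of_int l"
      by (simp_all add: mn field_simps)
    show "(case case p of (m, n) \<Rightarrow> ((m + n) div 2, (m - n) div 2) of
        (k, l) \<Rightarrow> gauss_exp (2 * \<tau>) (of_int k + 1/2) (2 * x) * gauss_exp (2 * \<tau>) (of_int l) (2 * y)) = h p"
      unfolding p prod.case kl h_def gauss_exp_mult by (simp only: e)
  qed (use 2 in \<open>auto simp: T_def\<close>)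
  have "(h has_sum (theta_even \<tau> x * theta_odd \<tau> y + theta_odd \<tau> x * theta_even \<tau> y)) (T \<union> - T)"
    by (rule has_sum_Un_disjoint[OF 3 4]) simp
  then show ?thesis using has_sum_unique[OF total] by simp
qed

lemma theta_even_shift: "theta_even \<tau> (z - of_real pi / 2) = theta_even \<tau> z"
proof -
  have "gauss_exp (2 * \<tau>) (of_int n) (2 * (z - of_real pi / 2)) = gauss_exp (2 * \<tau>) (of_int n) (2 * z)" for n :: int
  proof -
    have *: "2 * \<i> * of_real (of_int n) * (2 * (z - of_real pi / 2)) =
      2 * \<i> * of_real (of_int n) * (2 * z) - 2 * of_int n * of_real pi * \<i>"
      by (simp add: algebra_simps)
    have "exp (2 * of_int n * of_real pi * \<i>) = 1"
      using exp_2pi_1_int[of n] by (simp only: mult_ac)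
    then show ?thesis unfolding gauss_exp_def * exp_add exp_diff
      by simp
  qed
  then show ?thesis by (simp add: theta_even_def)
qed

text \<open>The half in the index leaves a factor exp(-i pi). This sign turns the symmetric
  expression for products of theta2 into a determinant for products of theta1.\<close>

lemma theta_odd_shift: "theta_odd \<tau> (z - of_real pi / 2) = - theta_odd \<tau> z"
proof -
  have "gauss_exp (2 * \<tau>) (of_int n + 1/2) (2 * (z - of_real pi / 2)) = - gauss_exp (2 * \<tau>) (of_int n + 1/2) (2 * z)" for n :: int
  proof -
    have *: "2 * \<i> * of_real (of_int n + 1/2) * (2 * (z - of_real pi / 2)) =
      2 * \<i> * of_real (of_int n + 1/2) * (2 * z) - 2 * of_int n * of_real pi * \<i> - of_real pi * \<i>"
      by (simp add: algebra_simps)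
    have "exp (2 * of_int n * of_real pi * \<i>) = 1"
      using exp_2pi_1_int[of n] by (simp only: mult_ac)
    then show ?thesis unfolding gauss_exp_def * exp_add exp_diff
      by simp
  qed
  then show ?thesis by (simp add: theta_odd_def infsum_uminus)
qed

lemma theta1_mult:
  "theta1 (x + y) \<tau> * theta1 (x - y) \<tau> = theta_even \<tau> x * theta_odd \<tau> y - theta_odd \<tau> x * theta_even \<tau> y"
proof -
  have "theta1 (x + y) \<tau> * theta1 (x - y) \<tau> =
      theta2 ((x - of_real pi / 2) + y) \<tau> * theta2 ((x - of_real pi / 2) - y) \<tau>"
    unfolding theta1_eq_theta2_shift by (simp add: algebra_simps)
  also have "\<dots> = theta_even \<tau> x * theta_odd \<tau> y - theta_odd \<tau> x * theta_even \<tau> y"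
    unfolding theta2_mult theta_even_shift theta_odd_shift by simp
  finally show ?thesis .
qed

lemma theta1_three_term:
  "theta1 (x + y) \<tau> * theta1 (x - y) \<tau> * (theta1 (z + w) \<tau> * theta1 (z - w) \<tau>)
   - theta1 (x + z) \<tau> * theta1 (x - z) \<tau> * (theta1 (y + w) \<tau> * theta1 (y - w) \<tau>)
   + theta1 (x + w) \<tau> * theta1 (x - w) \<tau> * (theta1 (y + z) \<tau> * theta1 (y - z) \<tau>) = 0"
  unfolding theta1_mult by (rule pluecker_relation)

end

section \<open>Zeros of the theta functions\<close>

definition qprod :: "complex \<Rightarrow> nat \<Rightarrow> complex" where
  "qprod Q n = (\<Prod>k<n. 1 - Q ^ Suc k)"

text \<open>With \<open>qprod\<close> the Pochhammer symbol (Q;Q)_n, this is the Gaussian binomial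
  coefficient of 2N+1 over N-n. The zero for n > N allows sums of any length over
  \<open>n\<close>.\<close>

definition jtp_coeff :: "complex \<Rightarrow> nat \<Rightarrow> nat \<Rightarrow> complex" where
  "jtp_coeff Q N n =
     (if n \<le> N then qprod Q (2 * N + 1) / (qprod Q (N - n) * qprod Q (N + n + 1)) else 0)"

lemma qprod_0 [simp]: "qprod Q 0 = 1"
  and qprod_Suc: "qprod Q (Suc n) = qprod Q n * (1 - Q ^ Suc n)"
  by (simp_all add: qprod_def)

lemma one_minus_power_nonzero:
  fixes Q :: complex
  assumes "norm Q < 1"
  shows "1 - Q ^ Suc k \<noteq> 0"
proof
  assume "1 - Q ^ Suc k = 0"
  then have "norm (Q ^ Suc k) = 1" by simp
  moreover have "norm (Q ^ Suc k) < 1"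
    unfolding norm_power using power_Suc_le_self[of "norm Q" k] assms by simp
  ultimately show False by simp
qed

context
  fixes Q :: complex
  assumes norm_Q: "norm Q < 1"
begin

lemma qprod_nonzero: "qprod Q n \<noteq> 0"
  using one_minus_power_nonzero[OF norm_Q] by (simp add: qprod_def)

text \<open>Comparison of coefficients when the partial product gains its next factor. All
  coefficients involved are rational multiples of the one at (N, m), so clearing denominators leaves
  a polynomial identity. The case m = N+1 is separate because that coefficient is then zero.\<close>

lemma jtp_coeff_rec:
  assumes "m \<le> Suc N"
  shows "jtp_coeff Q (Suc N) m = (1 + Q ^ (2 * N + 2)) * jtp_coeff Q N m
    + Q ^ (Suc N - m) * jtp_coeff Q N (m - 1) + Q ^ (N + m + 2) * jtp_coeff Q N (Suc m)"
proof (cases "m = Suc N")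
  case True
  then show ?thesis by (simp add: jtp_coeff_def qprod_nonzero mult_2)
next
  case False
  define a where "a = N - m"
  define b where "b = N + m"
  have N: "N = a + m" and b: "b = a + m + m" and ab: "2 * N = a + b"
    using assms False by (auto simp: a_def b_def)
  define c where "c = jtp_coeff Q N m"
  have nz: "1 - Q ^ Suc k \<noteq> 0" for k by (rule one_minus_power_nonzero[OF norm_Q])
  have c: "c = qprod Q (a + b + 1) / (qprod Q a * qprod Q (b + 1))"
    by (simp add: c_def jtp_coeff_def N b mult_2 add_ac)
  have c1: "jtp_coeff Q (Suc N) m * ((1 - Q ^ Suc a) * (1 - Q ^ (b + 2))) = c * ((1 - Q ^ (a + b + 2)) * (1 - Q ^ (a + b + 3)))"
  proof -
    have "jtp_coeff Q (Suc N) m = qprod Q (Suc (Suc (a + b + 1))) / (qprod Q (Suc a) * qprod Q (Suc (b + 1)))"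
      by (simp add: jtp_coeff_def N b Suc_diff_le mult_2 add_ac)
    moreover have "p * x * y / (q * u * (r * v)) * (u * v) = p / (q * r) * (x * y)"
      if "u \<noteq> 0" "v \<noteq> 0" for p q r x y u v :: complex
      using that by simp
    from this[OF nz nz]
    have "qprod Q (a + b + 1) * (1 - Q ^ Suc (a + b + 1)) * (1 - Q ^ Suc (Suc (a + b + 1))) /
        (qprod Q a * (1 - Q ^ Suc a) * (qprod Q (b + 1) * (1 - Q ^ Suc (b + 1)))) * ((1 - Q ^ Suc a) * (1 - Q ^ Suc (b + 1)))
      = c * ((1 - Q ^ Suc (a + b + 1)) * (1 - Q ^ Suc (Suc (a + b + 1))))"
      unfolding c .
    ultimately show ?thesis
      unfolding qprod_Suc by (simp add: eval_nat_numeral)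
  qed
  have c2: "jtp_coeff Q N (m - 1) * (1 - Q ^ Suc a) = c * (1 - Q ^ Suc b)"
  proof (cases m)
    \<comment> \<open>Truncated subtraction reads index -1 as 0. This is the right value: the
      binomials of 2N+1 over N+1 and over N agree.\<close>
    case 0
    then have "b = a" by (simp add: b)
    then show ?thesis using 0 by (simp add: c_def)
  next
    case (Suc m')
    have "jtp_coeff Q N (m - 1) = qprod Q (a + b + 1) / (qprod Q (Suc a) * qprod Q b)"
      using Suc by (simp add: jtp_coeff_def N b mult_2 add_ac)
    moreover have "p / (q * u * r) * u = p / (q * (r * v)) * v" if "u \<noteq> 0" "v \<noteq> 0" for p q r u v :: complex
      using that by simp
    from this[OF nz nz]
    have "qprod Q (a + b + 1) / (qprod Q a * (1 - Q ^ Suc a) * qprod Q b) * (1 - Q ^ Suc a) = c * (1 - Q ^ Suc b)"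
      unfolding c Suc_eq_plus1[symmetric] qprod_Suc .
    ultimately show ?thesis unfolding qprod_Suc by simp
  qed
  have c3: "jtp_coeff Q N (Suc m) * (1 - Q ^ (b + 2)) = c * (1 - Q ^ a)"
  proof (cases a)
    case 0
    then show ?thesis by (simp add: jtp_coeff_def N)
  next
    case (Suc a')
    have "jtp_coeff Q N (Suc m) = qprod Q (a + b + 1) / (qprod Q a' * qprod Q (b + 2))"
      using Suc by (simp add: jtp_coeff_def N b mult_2 add_ac)
    moreover have "p / (q * (r * v)) * v = p / (q * u * r) * u" if "u \<noteq> 0" "v \<noteq> 0" for p q r u v :: complex
      using that by simp
    from this[OF nz nz]
    have "qprod Q (a + b + 1) / (qprod Q a' * (qprod Q (b + 1) * (1 - Q ^ Suc (b + 1)))) * (1 - Q ^ Suc (b + 1)) = c * (1 - Q ^ Suc a')"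
      unfolding c Suc qprod_Suc .
    moreover have "b + 2 = Suc (b + 1)" by simp
    ultimately show ?thesis unfolding Suc by (simp only: qprod_Suc)
  qed
  \<comment> \<open>With A = Q^(N-m) and B = Q^(N+m+1) every power that occurs is a monomial in
    \<open>Q\<close>, \<open>A\<close> and \<open>B\<close>.\<close>
  define A where "A = Q ^ a"
  define B where "B = Q ^ b * Q"
  have pows: "Q ^ Suc a = Q * A" "Q ^ (b + 2) = Q * B" "Q ^ (a + b + 2) = Q * A * B" "Q ^ (a + b + 3) = Q\<^sup>2 * A * B"
    "Q ^ Suc b = B" "Q ^ (2 * N + 2) = Q * A * B" "Q ^ (Suc N - m) = Q * A" "Q ^ (N + m + 2) = Q * B" "Q ^ a = A"
    by (simp_all add: A_def B_def ab power_add eval_nat_numeral N Suc_diff_le b)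
  have nzB: "1 - Q * B \<noteq> 0" using nz[of "Suc b"] by (simp add: B_def mult_ac)
  have nzA: "1 - Q * A \<noteq> 0" using nz[of a] by (simp add: A_def)
  define x y z where "x = jtp_coeff Q (Suc N) m" and "y = jtp_coeff Q N (m - 1)" and "z = jtp_coeff Q N (Suc m)"
  have x: "x * ((1 - Q * A) * (1 - Q * B)) = c * ((1 - Q * A * B) * (1 - Q\<^sup>2 * A * B))"
    and y: "y * (1 - Q * A) = c * (1 - B)" and z: "z * (1 - Q * B) = c * (1 - A)"
    using c1 c2 c3 unfolding x_def y_def z_def pows by simp_all
  have "x * ((1 - Q * A) * (1 - Q * B)) =
     (1 + Q * A * B) * c * ((1 - Q * A) * (1 - Q * B)) + Q * A * (y * (1 - Q * A)) * (1 - Q * B) + Q * B * (z * (1 - Q * B)) * (1 - Q * A)"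
    unfolding x y z by (simp add: algebra_simps power2_eq_square)
  also have "\<dots> = ((1 + Q * A * B) * c + Q * A * y + Q * B * z) * ((1 - Q * A) * (1 - Q * B))"
    by (simp add: algebra_simps)
  finally have "x = (1 + Q * A * B) * c + Q * A * y + Q * B * z"
    using nzA nzB by simp
  then show ?thesis
    unfolding x_def y_def z_def c_def pows by simp
qed

text \<open>Induction on \<open>N\<close>: the new factor contains cos(2z), which sends sin((2n+1)z)
  to its two neighbours, so the coefficients obey the three-term recurrence
  \<open>jtp_coeff_rec\<close>. Symmetry under z to -z lets sines with n >= 0 replace the usual
  two-sided Laurent sum.\<close>

lemma jacobi_triple_product_finite:
  "sin z * (\<Prod>k<N. 1 - 2 * Q ^ Suc k * cos (2 * z) + Q ^ (2 * Suc k)) =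
   (\<Sum>n\<le>N. jtp_coeff Q N n * ((-1) ^ n * Q ^ (n * Suc n div 2) * sin ((2 * of_nat n + 1) * z)))"
proof (induction N)
  case 0
  show ?case using qprod_nonzero[of 1] by (simp add: jtp_coeff_def)
next
  case (Suc N)
  define S where "S = (\<lambda>n::nat. sin ((2 * of_nat n + 1) * z))"
  define T where "T = (\<lambda>n::nat. n * Suc n div 2)"
  define c where "c = jtp_coeff Q N"
  have T: "T (Suc n) = T n + Suc n" for n
  proof -
    have *: "Suc n * Suc (Suc n) = n * Suc n + 2 * Suc n" by simp
    have "(a + 2 * b) div 2 = a div 2 + b" for a b :: nat by simp
    then show ?thesis unfolding T_def * .
  qed
  have T0: "T 0 = 0" by (simp add: T_def)
  \<comment> \<open>These zeros let the upper limits of the sums below move between \<open>N\<close>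
    and \<open>Suc N\<close>.\<close>
  have cz: "c (Suc N) = 0" "c (Suc (Suc N)) = 0" by (simp_all add: c_def jtp_coeff_def)
  \<comment> \<open>The lower neighbour of sin z is sin(-z) = -sin z, a boundary term of its
    own.\<close>
  have S0: "2 * cos (2 * z) * S 0 = S 1 - S 0"
    using sin_times_cos[of z "2 * z"] by (simp add: S_def mult_ac)
  have S1: "2 * cos (2 * z) * S (Suc n) = S (Suc (Suc n)) + S n" for n
  proof -
    have eq: "(2 * of_nat (Suc n) + 1) * z + 2 * z = (2 * of_nat (Suc (Suc n)) + 1) * z"
      "(2 * of_nat (Suc n) + 1) * z - 2 * z = (2 * of_nat n + 1) * z"
      by (simp_all add: algebra_simps)
    have "S (Suc n) * cos (2 * z) = (S (Suc (Suc n)) + S n) / 2"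
      unfolding S_def sin_times_cos eq ..
    then show ?thesis by (simp add: mult_ac)
  qed
  define e where "e = (\<lambda>n. (-1) ^ n * Q ^ T n)"
  define X where "X = Q ^ Suc N"
  have "(\<Sum>n\<le>N. c n * (e n * S n)) * (2 * cos (2 * z)) = (\<Sum>n\<le>Suc N. c n * e n * (2 * cos (2 * z) * S n))"
    using cz by (simp add: sum_distrib_right sum_distrib_left mult_ac)
  also have "\<dots> = c 0 * e 0 * (S 1 - S 0) + (\<Sum>n\<le>N. c (Suc n) * e (Suc n) * (S (Suc (Suc n)) + S n))"
    unfolding sum.atMost_Suc_shift S0 S1 ..
  also have "\<dots> = c 0 * e 0 * (S 1 - S 0) + (\<Sum>n\<le>N. c (Suc n) * e (Suc n) * S (Suc (Suc n)))
      + (\<Sum>n\<le>Suc N. c (Suc n) * e (Suc n) * S n)"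
    using cz by (simp add: sum.distrib distrib_left)
  also have "c 0 * e 0 * (S 1 - S 0) + (\<Sum>n\<le>N. c (Suc n) * e (Suc n) * S (Suc (Suc n))) =
      - c 0 * e 0 * S 0 + (\<Sum>n\<le>Suc N. c n * e n * S (Suc n))"
    unfolding sum.atMost_Suc_shift[of "\<lambda>n. c n * e n * S (Suc n)"] by (simp add: algebra_simps)
  also have "(\<Sum>n\<le>Suc N. c n * e n * S (Suc n)) = (\<Sum>n\<le>N. c n * e n * S (Suc n))"
    using cz by simp
  finally have cosum: "(\<Sum>n\<le>N. c n * (e n * S n)) * (2 * cos (2 * z)) =
      - c 0 * e 0 * S 0 + (\<Sum>n\<le>N. c n * e n * S (Suc n)) + (\<Sum>n\<le>Suc N. c (Suc n) * e (Suc n) * S n)" .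
  have plain: "(\<Sum>n\<le>N. c n * (e n * S n)) = (\<Sum>n\<le>Suc N. c n * e n * S n)"
    using cz by (simp add: mult_ac)
  have "sin z * (\<Prod>k<Suc N. 1 - 2 * Q ^ Suc k * cos (2 * z) + Q ^ (2 * Suc k)) =
     (\<Sum>n\<le>N. c n * (e n * S n)) * (1 - 2 * X * cos (2 * z) + X\<^sup>2)"
    using Suc.IH unfolding c_def e_def S_def T_def X_def by (simp add: power_even_eq power_mult_distrib mult.assoc[symmetric] power2_eq_square)
  also have "\<dots> = (1 + X\<^sup>2) * (\<Sum>n\<le>N. c n * (e n * S n)) - X * ((\<Sum>n\<le>N. c n * (e n * S n)) * (2 * cos (2 * z)))"
    by (simp add: algebra_simps)
  also have "\<dots> = (\<Sum>n\<le>Suc N. (1 + X\<^sup>2) * c n * e n * S n) + X * c 0 * e 0 * S 0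
     - (\<Sum>n\<le>N. X * c n * e n * S (Suc n)) - (\<Sum>n\<le>Suc N. X * c (Suc n) * e (Suc n) * S n)"
    unfolding cosum unfolding plain by (simp add: sum_distrib_left algebra_simps)
  finally have step: "sin z * (\<Prod>k<Suc N. 1 - 2 * Q ^ Suc k * cos (2 * z) + Q ^ (2 * Suc k)) =
     (\<Sum>n\<le>Suc N. (1 + X\<^sup>2) * c n * e n * S n)
     + (X * c 0 * e 0 * S 0 - (\<Sum>n\<le>N. X * c n * e n * S (Suc n))) - (\<Sum>n\<le>Suc N. X * c (Suc n) * e (Suc n) * S n)"
    by (simp add: algebra_simps)
  \<comment> \<open>The boundary term becomes the summand n = 0, where \<open>n - 1\<close> is 0.
    The powers match because N+1 plus the n-th triangular number is N-n plus the next one.\<close>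
  have mid: "X * c 0 * e 0 * S 0 - (\<Sum>n\<le>N. X * c n * e n * S (Suc n)) = (\<Sum>n\<le>Suc N. Q ^ (Suc N - n) * c (n - 1) * e n * S n)"
  proof -
    have "- (X * c n * e n * S (Suc n)) = Q ^ (N - n) * c n * e (Suc n) * S (Suc n)" if "n \<le> N" for n
    proof -
      have "X * Q ^ T n = Q ^ (N - n) * Q ^ T (Suc n)"
        unfolding X_def T power_add[symmetric] using that by (intro arg_cong[of _ _ "\<lambda>k. Q ^ k"]) simp
      then show ?thesis by (simp add: e_def mult_ac)
    qed
    then have "- (\<Sum>n\<le>N. X * c n * e n * S (Suc n)) = (\<Sum>n\<le>N. Q ^ (N - n) * c n * e (Suc n) * S (Suc n))"
      unfolding sum_negf[symmetric] by (intro sum.cong) auto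
    then show ?thesis
      unfolding sum.atMost_Suc_shift[of "\<lambda>n. Q ^ (Suc N - n) * c (n - 1) * e n * S n"]
      by (simp add: X_def T0 e_def)
  qed

  have "X * c (Suc n) * e (Suc n) * S n = - (Q ^ (N + n + 2) * c (Suc n) * e n * S n)" for n
  proof -
    have "X * Q ^ T (Suc n) = Q ^ (N + n + 2) * Q ^ T n"
      unfolding X_def T power_add[symmetric] by (intro arg_cong[of _ _ "\<lambda>k. Q ^ k"]) simp
    then show ?thesis by (simp add: e_def mult_ac)
  qed
  then have "sin z * (\<Prod>k<Suc N. 1 - 2 * Q ^ Suc k * cos (2 * z) + Q ^ (2 * Suc k)) =
      (\<Sum>n\<le>Suc N. (1 + X\<^sup>2) * c n * e n * S n + Q ^ (Suc N - n) * c (n - 1) * e n * S n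
         + Q ^ (N + n + 2) * c (Suc n) * e n * S n)"
    unfolding step mid by (simp only: sum.distrib sum_negf) simp
  also have "\<dots> = (\<Sum>n\<le>Suc N. jtp_coeff Q (Suc N) n * (e n * S n))"
  proof (rule sum.cong[OF refl])
    fix n assume "n \<in> {..Suc N}"
    moreover have "X\<^sup>2 = Q ^ (2 * N + 2)"
      unfolding X_def power_mult[symmetric] by (intro arg_cong[of _ _ "\<lambda>k. Q ^ k"]) simp
    ultimately show "(1 + X\<^sup>2) * c n * e n * S n + Q ^ (Suc N - n) * c (n - 1) * e n * S n
         + Q ^ (N + n + 2) * c (Suc n) * e n * S n = jtp_coeff Q (Suc N) n * (e n * S n)"
      by (simp add: jtp_coeff_rec c_def algebra_simps)
  qed
  finally show ?case unfolding e_def S_def T_def .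
qed

section \<open>The limit of the triple product coefficients\<close>

lemma qprod_tendsto: "\<exists>E. E \<noteq> 0 \<and> qprod Q \<longlonglongrightarrow> E"
proof -
  have sm: "summable (\<lambda>k. norm ((1 - Q ^ Suc k) - 1))"
    using summable_geometric[of "norm Q"] norm_Q
    by (simp add: norm_mult norm_power summable_mult)
  have "convergent_prod (\<lambda>k. 1 - Q ^ Suc k)"
    by (intro abs_convergent_prod_imp_convergent_prod summable_imp_abs_convergent_prod sm)
  then obtain E where E: "(\<lambda>k. 1 - Q ^ Suc k) has_prod E"
    using convergent_prod_has_prod by blast
  have "E \<noteq> 0" using has_prod_eq_0_iff[OF E] one_minus_power_nonzero[OF norm_Q] by force
  moreover have "qprod Q \<longlonglongrightarrow> E"
    using has_prod_imp_tendsto'[OF E] by (simp add: qprod_def[abs_def])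
  ultimately show ?thesis by blast
qed

text \<open>One Euler product above and two below the fraction line: every coefficient tends to the
  same limit E/(E E), whatever \<open>n\<close> is, so the constant can be pulled out of the limit
  series.\<close>

lemma jtp_coeff_tendsto: "\<exists>E. E \<noteq> 0 \<and> (\<forall>n. (\<lambda>N. jtp_coeff Q N n) \<longlonglongrightarrow> inverse E)"
proof -
  obtain E where E: "E \<noteq> 0" and lim: "qprod Q \<longlonglongrightarrow> E" using qprod_tendsto by blast
  have sub: "filterlim g at_top sequentially \<Longrightarrow> (\<lambda>N. qprod Q (g N)) \<longlonglongrightarrow> E" for g
    using filterlim_compose[OF lim] .
  have "(\<lambda>N. jtp_coeff Q N n) \<longlonglongrightarrow> inverse E" for n
  proof -
    have g: "filterlim (\<lambda>N. 2 * N + 1) at_top sequentially" "filterlim (\<lambda>N. N - n) at_top sequentially"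
        "filterlim (\<lambda>N. N + n + 1) at_top sequentially"
      by (auto intro!: filterlim_subseq filterlim_minus_const_nat_at_top simp: strict_mono_def)
    have "(\<lambda>N. qprod Q (2 * N + 1) / (qprod Q (N - n) * qprod Q (N + n + 1))) \<longlonglongrightarrow> E / (E * E)"
      using E by (intro tendsto_divide tendsto_mult sub g) auto
    moreover have "eventually (\<lambda>N. qprod Q (2 * N + 1) / (qprod Q (N - n) * qprod Q (N + n + 1)) = jtp_coeff Q N n) sequentially"
      using eventually_ge_at_top[of n] by eventually_elim (simp add: jtp_coeff_def)
    ultimately show ?thesis using E by (simp add: tendsto_cong field_simps)
  qed
  with E show ?thesis by blast
qed

text \<open>Uniformity in both indices supplies the dominating series for the exchange of limit and
  sum. Since the limit of \<open>qprod\<close> is nonzero, the inverses are bounded too.\<close>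

lemma jtp_coeff_bounded: "\<exists>K. \<forall>N n. norm (jtp_coeff Q N n) \<le> K"
proof -
  obtain E where E: "E \<noteq> 0" and lim: "qprod Q \<longlonglongrightarrow> E" using qprod_tendsto by blast
  obtain U where U: "norm (qprod Q n) \<le> U" for n
    using convergent_imp_Bseq[OF convergentI[OF lim]] by (auto simp: Bseq_def)
  obtain L where L: "norm (inverse (qprod Q n)) \<le> L" for n
    using convergent_imp_Bseq[OF convergentI[OF tendsto_inverse[OF lim E]]] by (auto simp: Bseq_def)
  have nn: "0 \<le> U" "0 \<le> L" using U[of 0] L[of 0] norm_ge_zero order_trans by blast+
  have "norm (jtp_coeff Q N n) \<le> U * (L * L)" for N n
  proof (cases "n \<le> N")
    case True
    then have "norm (jtp_coeff Q N n) = norm (qprod Q (2 * N + 1)) *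
        (norm (inverse (qprod Q (N - n))) * norm (inverse (qprod Q (N + n + 1))))"
      by (simp add: jtp_coeff_def norm_divide norm_mult norm_inverse divide_simps)
    also have "\<dots> \<le> U * (L * L)"
      by (intro mult_mono U L mult_nonneg_nonneg norm_ge_zero nn)
    finally show ?thesis .
  qed (use nn in \<open>simp add: jtp_coeff_def\<close>)
  then show ?thesis by blast
qed

end

text \<open>The trigonometric factor splits as (1 - exp(2iz) q)(1 - exp(-2iz) q).\<close>

lemma factor_nonzero:
  fixes z Q :: complex
  assumes "exp (2 * \<i> * z) * q \<noteq> 1" "exp (- (2 * \<i> * z)) * q \<noteq> 1"
  shows "1 - 2 * q * cos (2 * z) + q\<^sup>2 \<noteq> 0"
proof -
  have "exp (2 * \<i> * z) * exp (- (2 * \<i> * z)) = 1"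
    by (simp flip: exp_add)
  then have "1 - 2 * q * cos (2 * z) + q\<^sup>2 = (1 - exp (2 * \<i> * z) * q) * (1 - exp (- (2 * \<i> * z)) * q)"
    by (simp add: cos_exp_eq mult.assoc algebra_simps power2_eq_square)
  then show ?thesis using assms by auto
qed

section \<open>The product formula and zero-free regions of theta1\<close>

context
  fixes \<tau> :: complex
  assumes Im_tau: "Im \<tau> > 0"
begin

text \<open>As (n + 1/2)^2 = 1/4 + n(n+1), the theta coefficients are, up to a constant, the
  triangular powers of the squared nome that occur in the finite triple product.\<close>

lemma nome_pow_square:
  "nome_pow \<tau> ((real n + 1/2)\<^sup>2) = nome_pow \<tau> (1/4) * exp (2 * \<i> * of_real pi * \<tau>) ^ (n * Suc n div 2)"
proof -
  have "even (n * Suc n)" by simp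
  then obtain k where k: "n * Suc n = 2 * k" by blast
  have sq: "(real n + 1/2)\<^sup>2 = 1/4 + 2 * real k"
    using arg_cong[OF k, of real] by (simp add: power2_eq_square algebra_simps)
  show ?thesis
    unfolding k sq nome_pow_def by (simp add: exp_of_nat_mult[symmetric] exp_add[symmetric] algebra_simps)
qed

text \<open>The limit of the finite identity is the classical formula theta1(z) = 2 q E p sin z,
  where \<open>q\<close> is the nome to the power 1/4, \<open>E\<close> the nonzero constant from
  \<open>jtp_coeff_tendsto\<close> and \<open>p\<close> the infinite product over \<open>P\<close>.
  The hypotheses say that no factor is zero.\<close>

lemma theta1_nonzero_product:
  assumes "sin z \<noteq> 0"
    and "\<And>k. exp (2 * \<i> * z) * exp (2 * \<i> * of_real pi * \<tau>) ^ Suc k \<noteq> 1"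
    and "\<And>k. exp (- (2 * \<i> * z)) * exp (2 * \<i> * of_real pi * \<tau>) ^ Suc k \<noteq> 1"
  shows "theta1 z \<tau> \<noteq> 0"
proof -
  define Q where "Q = exp (2 * \<i> * of_real pi * \<tau>)"
  have Q: "norm Q < 1" using Im_tau by (simp add: Q_def)
  define P where "P = (\<lambda>k. 1 - 2 * Q ^ Suc k * cos (2 * z) + Q ^ (2 * Suc k))"
  have P: "P k \<noteq> 0" for k
    using factor_nonzero[OF assms(2,3)[of k]] by (simp only: P_def Q_def power_even_eq not_False_eq_True)
  have g: "summable (\<lambda>k. norm Q ^ k)" using Q by simp
  have g2: "summable (\<lambda>k. (norm Q ^ 2) ^ k)" using Q by (simp add: abs_square_less_1)
  have "summable (\<lambda>k. (2 * norm Q * norm (cos (2 * z))) * norm Q ^ k + norm Q ^ 2 * (norm Q ^ 2) ^ k)"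
    by (intro summable_add summable_mult g g2)
  then have "summable (\<lambda>k. norm (P k - 1))"
  proof (rule summable_comparison_test')
    fix k
    have "norm (P k - 1) \<le> norm (2 * Q ^ Suc k * cos (2 * z)) + norm (Q ^ (2 * Suc k))"
      unfolding P_def using norm_triangle_ineq4[of "Q ^ (2 * Suc k)" "2 * Q ^ Suc k * cos (2 * z)"]
      by (simp add: algebra_simps)
    then show "norm (norm (P k - 1)) \<le> (2 * norm Q * norm (cos (2 * z))) * norm Q ^ k + norm Q ^ 2 * (norm Q ^ 2) ^ k"
      by (simp add: norm_mult norm_power power_mult mult_ac power2_eq_square power_mult_distrib)
  qed
  then have "convergent_prod P"
    by (intro abs_convergent_prod_imp_convergent_prod summable_imp_abs_convergent_prod)
  then obtain p where p: "P has_prod p" using convergent_prod_has_prod by blast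
  have "p \<noteq> 0" using has_prod_eq_0_iff[OF p] P by force
  define t where "t = (\<lambda>n. (-1) ^ n * Q ^ (n * Suc n div 2) * sin ((2 * of_nat n + 1) * z))"
  have "(\<lambda>N. sin z * (\<Prod>k<N. P k)) \<longlonglongrightarrow> sin z * p"
    by (intro tendsto_intros has_prod_imp_tendsto'[OF p])
  \<comment> \<open>The finite sum is rewritten as a series, since its coefficients vanish beyond
    \<open>N\<close>; Tannery's theorem can then evaluate the same limit in a second way.\<close>
  then have lim1: "(\<lambda>N. \<Sum>n. jtp_coeff Q N n * t n) \<longlonglongrightarrow> sin z * p"
  proof (rule Lim_transform_eventually, intro always_eventually allI)
    fix N
    have "(\<Sum>n. jtp_coeff Q N n * t n) = (\<Sum>n\<le>N. jtp_coeff Q N n * t n)"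
      by (intro suminf_finite) (auto simp: jtp_coeff_def)
    then show "sin z * (\<Prod>k<N. P k) = (\<Sum>n. jtp_coeff Q N n * t n)"
      using jacobi_triple_product_finite[OF Q, of z N] by (simp add: P_def t_def)
  qed
  obtain E where E: "E \<noteq> 0" "\<And>n. (\<lambda>N. jtp_coeff Q N n) \<longlonglongrightarrow> inverse E"
    using jtp_coeff_tendsto[OF Q] by blast
  obtain K where K: "norm (jtp_coeff Q N n) \<le> K" for N n
    using jtp_coeff_bounded[OF Q] by blast
  define q where "q = nome_pow \<tau> (1/4)"
  have q: "q \<noteq> 0" by (simp add: q_def nome_pow_def)
  have t: "2 * ((-1) ^ n * nome_pow \<tau> ((real n + 1/2)\<^sup>2) * sin ((2 * of_nat n + 1) * z)) = 2 * q * t n" for n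
    by (simp add: nome_pow_square t_def q_def Q_def)
  have "summable (\<lambda>n. norm (2 * q * t n))"
    using theta1_abs_summable[OF Im_tau, of z] unfolding t .
  from summable_mult[OF this, of "inverse (norm (2 * q))"] have tn: "summable (\<lambda>n. norm (t n))"
    using q by (simp add: norm_mult)
  have tsum: "2 * q * (\<Sum>n. t n) = theta1 z \<tau>"
    using theta1_sums[OF Im_tau, of z] suminf_mult[OF summable_norm_cancel[OF tn], of "2 * q"]
    unfolding t by (simp add: sums_iff)
  have "(\<lambda>N. \<Sum>n. jtp_coeff Q N n * t n) \<longlonglongrightarrow> (\<Sum>n. inverse E * t n)"
  proof -
    have "\<forall>\<^sub>F x in at_top \<times>\<^sub>F sequentially. case x of (n, N) \<Rightarrow> norm (jtp_coeff Q N n * t n) \<le> K * norm (t n)"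
      by (intro always_eventually) (auto simp: norm_mult intro!: mult_right_mono K)
    from tannerys_theorem[OF tendsto_mult_right[OF E(2)] this summable_mult[OF tn] trivial_limit_sequentially]
    show ?thesis by blast
  qed
  with lim1 have "sin z * p = (\<Sum>n. inverse E * t n)" by (rule LIMSEQ_unique)
  also have "\<dots> = inverse E * (\<Sum>n. t n)" by (intro suminf_mult summable_norm_cancel[OF tn])
  finally show ?thesis using \<open>p \<noteq> 0\<close> q assms(1) tsum by auto
qed

text \<open>Here |exp(2iz)| and |exp(-2iz)| are both less than 1/|Q| for the squared nome Q, so no
  factor with a positive power of Q can vanish.\<close>

lemma theta1_nonzero:
  assumes "sin z \<noteq> 0" and "\<bar>Im z\<bar> < pi * Im \<tau>"
  shows "theta1 z \<tau> \<noteq> 0"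
proof -
  have ne: "exp w * exp (2 * \<i> * of_real pi * \<tau>) ^ Suc k \<noteq> 1" if "Re w < 2 * (pi * Im \<tau>)" for w k
  proof
    assume "exp w * exp (2 * \<i> * of_real pi * \<tau>) ^ Suc k = 1"
    then have "norm (exp w * exp (2 * \<i> * of_real pi * \<tau>) ^ Suc k) = 1" by simp
    then have "Re w - real (Suc k) * (2 * (pi * Im \<tau>)) = 0"
      by (simp add: norm_mult norm_power exp_of_nat_mult[symmetric] exp_add[symmetric] exp_minus[symmetric] mult_ac del: of_nat_Suc power_Suc)
    moreover have "real (Suc k) * (2 * (pi * Im \<tau>)) \<ge> 1 * (2 * (pi * Im \<tau>))"
      using Im_tau by (intro mult_right_mono) auto
    ultimately show False using that by simp
  qed
  show ?thesis
    by (rule theta1_nonzero_product[OF assms(1) ne ne]) (use assms(2) in auto)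
qed

lemma theta1_nonzero_strip:
  assumes "0 < Im z" and "Im z < pi * Im \<tau>"
  shows "theta1 z \<tau> \<noteq> 0"
proof (rule theta1_nonzero)
  show "sin z \<noteq> 0"
  proof
    assume "sin z = 0"
    then obtain n :: int where "z = of_real (n * pi)" by (auto simp: sin_eq_0)
    then show False using assms by simp
  qed
qed (use assms in auto)

lemma theta2_nonzero_strip:
  assumes "0 < Im z" and "Im z < pi * Im \<tau>"
  shows "theta2 z \<tau> \<noteq> 0"
  unfolding theta1_add_pi_half[OF Im_tau, symmetric] using assms by (intro theta1_nonzero_strip) auto

lemma theta1_nonzero_real:
  assumes "0 < x" and "x < pi"
  shows "theta1 (of_real x) \<tau> \<noteq> 0"
proof (rule theta1_nonzero)
  show "sin (complex_of_real x) \<noteq> 0"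
    using sin_gt_zero[OF assms] by (simp add: sin_of_real)
qed (use Im_tau in auto)

text \<open>The range of \<open>w\<close> is twice what \<open>theta1_nonzero\<close> covers. For Re
  \<tau> = 1/2 the squared nome is a negative real -r, so for k = 0 the product in question is
  negative and cannot be 1. Later powers are at most r^2 in modulus and stay below 1 against exp(2w)
  as long as w < 2 pi Im \<tau>.\<close>

lemma theta1_nonzero_imag:
  assumes "Re \<tau> = 1/2" and "0 < w" and "w < 2 * pi * Im \<tau>"
  shows "theta1 (\<i> * of_real w) \<tau> \<noteq> 0"
proof (rule theta1_nonzero_product)
  show "sin (\<i> * of_real w) \<noteq> 0"
  proof
    assume "sin (\<i> * of_real w) = 0"
    then obtain n :: int where "\<i> * of_real w = of_real (n * pi)" by (auto simp: sin_eq_0)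
    then have "Im (\<i> * of_real w) = Im (of_real (n * pi))" by simp
    then show False using assms by simp
  qed
  define r where "r = exp (- (2 * (pi * Im \<tau>)))"
  have "exp (2 * \<i> * of_real pi * \<tau>) = exp (of_real (- (2 * (pi * Im \<tau>))) + \<i> * of_real pi)"
    using assms(1) by (intro arg_cong[of _ _ exp]) (simp add: complex_eq_iff)
  also have "\<dots> = - of_real r"
    by (simp only: exp_add exp_of_real r_def) simp
  finally have Q: "exp (2 * \<i> * of_real pi * \<tau>) = of_real (- r)" by simp
  have ne: "exp (of_real y) * exp (2 * \<i> * of_real pi * \<tau>) ^ Suc k \<noteq> 1" if "y < 4 * (pi * Im \<tau>)" for y k
  proof
    assume "exp (of_real y) * exp (2 * \<i> * of_real pi * \<tau>) ^ Suc k = 1"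
    then have *: "exp y * (- r) ^ Suc k = 1"
      unfolding Q by (metis exp_of_real of_real_1 of_real_eq_iff of_real_mult of_real_power)
    have "r > 0" by (simp add: r_def)
    show False
    proof (cases k)
      case 0
      then have "exp y * r = -1" using * by simp
      then show False using mult_pos_pos[OF exp_gt_zero[of y] \<open>r > 0\<close>] by simp
    next
      case (Suc m)
      have "\<bar>exp y * (- r) ^ Suc k\<bar> = exp y * r ^ Suc k"
        using \<open>r > 0\<close> by (simp add: abs_mult power_abs)
      also have "r ^ Suc k \<le> r ^ 2"
        using Im_tau \<open>r > 0\<close> Suc by (intro power_decreasing) (auto simp: r_def)
      also have "exp y * r ^ 2 = exp (y - 4 * (pi * Im \<tau>))"
        by (simp add: r_def exp_of_nat_mult[symmetric] exp_add[symmetric] del: exp_of_nat_mult)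
      also have "\<dots> < 1" using that by simp
      finally show False using * by simp
    qed
  qed
  show "exp (2 * \<i> * (\<i> * of_real w)) * exp (2 * \<i> * of_real pi * \<tau>) ^ Suc k \<noteq> 1" for k
  proof -
    have e: "2 * \<i> * (\<i> * of_real w) = of_real (- 2 * w)" by (simp add: complex_eq_iff)
    show ?thesis unfolding e by (rule ne) (use assms Im_tau in \<open>simp add: add_pos_pos\<close>)
  qed
  show "exp (- (2 * \<i> * (\<i> * of_real w))) * exp (2 * \<i> * of_real pi * \<tau>) ^ Suc k \<noteq> 1" for k
  proof -
    have e: "- (2 * \<i> * (\<i> * of_real w)) = of_real (2 * w)" by (simp add: complex_eq_iff)
    show ?thesis unfolding e by (rule ne) (use assms in simp)
  qed
qed

end

section \<open>The planar curves\<close>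

context
  fixes \<tau> :: complex
  assumes Im_tau: "Im \<tau> > 0"
begin

abbreviation (input) "th1 z \<equiv> theta1 z \<tau>"
abbreviation (input) "th2 z \<equiv> theta2 z \<tau>"

lemma theta1_minus_pi_half: "th1 (z - of_real pi / 2) = - th2 z"
  using theta1_add_pi_half[OF Im_tau, of "- z"] theta1_minus[OF Im_tau, of "z - of_real pi / 2"]
  by (simp add: theta2_minus[OF Im_tau])

text \<open>The three-term relation at \<open>x, \<omega>, v, \<pi>/2\<close>, differentiated at \<open>v = \<omega>\<close>.\<close>

lemma theta_wronskian:
  "(deriv th1 (x - \<omega>) * th1 (x + \<omega>) - th1 (x - \<omega>) * deriv th1 (x + \<omega>)) * (th2 \<omega>)\<^sup>2 =
   dtheta1_0 \<tau> * th1 (2 * \<omega>) * (th2 x)\<^sup>2 - 2 * th1 (x + \<omega>) * th1 (x - \<omega>) * th2 \<omega> * deriv th2 \<omega>"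
proof -
  define F where "F = (\<lambda>v. th1 (x + v) * th1 (x - v) * (th2 \<omega>)\<^sup>2 - th1 (x + \<omega>) * th1 (x - \<omega>) * (th2 v)\<^sup>2
      - (th2 x)\<^sup>2 * (th1 (\<omega> + v) * th1 (\<omega> - v)))"
  have "F v = 0" for v
    using theta1_three_term[OF Im_tau, of x \<omega> v "of_real pi / 2"]
    unfolding theta1_add_pi_half[OF Im_tau] theta1_minus_pi_half
    by (simp add: F_def power2_eq_square algebra_simps)
  then have "(F has_field_derivative 0) (at \<omega>)" by (simp add: F_def)
  \<comment> \<open>At v = \<omega> the last product of \<open>F\<close> contains theta1(0) = 0, so
    only the derivative of that factor survives; this is where theta1'(0) enters.\<close>
  moreover have "(F has_field_derivative
      ((deriv th1 (x + \<omega>) * th1 (x - \<omega>) - th1 (x + \<omega>) * deriv th1 (x - \<omega>)) * (th2 \<omega>)\<^sup>2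
       - th1 (x + \<omega>) * th1 (x - \<omega>) * (2 * th2 \<omega> * deriv th2 \<omega>)
       + (th2 x)\<^sup>2 * (th1 (2 * \<omega>) * deriv th1 0))) (at \<omega>)"
    unfolding F_def
    by (rule derivative_eq_intros theta1_has_field_derivative[OF Im_tau] theta2_has_field_derivative[OF Im_tau] refl)+
      (simp add: theta1_0[OF Im_tau] algebra_simps power2_eq_square)
  ultimately show ?thesis
    using DERIV_unique unfolding dtheta1_0_def by (fastforce simp: algebra_simps)
qed

text \<open>The three-term relation at \<open>d/2 + \<pi>/2, d/2 + \<omega>, x - d/2, d/2 - \<omega>\<close>.\<close>

lemma theta_addition:
  "th2 (\<omega> + d) * th1 (x - \<omega>) * th1 (x - d + \<omega>) * th2 \<omega> - th2 (\<omega> - d) * th1 (x - d - \<omega>) * th1 (x + \<omega>) * th2 \<omega>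
   = th1 d * th1 (2 * \<omega>) * th2 x * th2 (x - d)"
proof -
  define h where "h = complex_of_real pi / 2"
  have args: "(d/2 + h) + (d/2 + \<omega>) = (\<omega> + d) + h" "(d/2 + h) - (d/2 + \<omega>) = (- \<omega>) + h"
    "(x - d/2) + (d/2 - \<omega>) = x - \<omega>" "(x - d/2) - (d/2 - \<omega>) = x - d + \<omega>"
    "(d/2 + h) + (x - d/2) = x + h" "(d/2 + h) - (x - d/2) = (- (x - d)) + h"
    "(d/2 + \<omega>) + (d/2 - \<omega>) = d" "(d/2 + \<omega>) - (d/2 - \<omega>) = 2 * \<omega>"
    "(d/2 + h) + (d/2 - \<omega>) = (- (\<omega> - d)) + h" "(d/2 + h) - (d/2 - \<omega>) = \<omega> + h"
    "(d/2 + \<omega>) + (x - d/2) = x + \<omega>" "(d/2 + \<omega>) - (x - d/2) = - (x - d - \<omega>)"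
    by (simp_all add: field_simps)
  have hh: "th1 (z + h) = th2 z" for z
    unfolding h_def by (rule theta1_add_pi_half[OF Im_tau])
  from theta1_three_term[OF Im_tau, of "d/2 + h" "d/2 + \<omega>" "x - d/2" "d/2 - \<omega>"]
  show ?thesis
    unfolding args hh theta1_minus[OF Im_tau] theta2_minus[OF Im_tau] by (simp add: algebra_simps)
qed

text \<open>The nonvanishing lemmas are silent at z = 0, where sin z = 0. If the derivative were
  zero, \<open>theta_wronskian\<close> would make theta1(x+\<omega>) theta1(x-\<omega>) /
  theta2(\<omega>)^2 constant in \<omega>; yet it vanishes at \<omega> = x and not at \<omega> = 0.
  With x = pi/4 the segment avoids the zeros of theta2.\<close>

lemma dtheta1_0_nonzero: "dtheta1_0 \<tau> \<noteq> 0"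
proof
  assume "dtheta1_0 \<tau> = 0"
  then have wr: "(deriv th1 (x - \<omega>) * th1 (x + \<omega>) - th1 (x - \<omega>) * deriv th1 (x + \<omega>)) * (th2 \<omega>)\<^sup>2 =
       - 2 * th1 (x + \<omega>) * th1 (x - \<omega>) * th2 \<omega> * deriv th2 \<omega>" for x \<omega>
    by (simp add: theta_wronskian)
  define x :: complex where "x = of_real (pi / 4)"
  have nz: "th2 \<omega> \<noteq> 0" if mem: "\<omega> \<in> closed_segment 0 x" for \<omega>
  proof -
    obtain t where t: "0 \<le> t" "t \<le> 1" "\<omega> = of_real t * x"
      using mem by (auto simp: closed_segment_def scaleR_conv_of_real)
    have "t * (pi / 4) \<le> 1 * (pi / 4)" "0 \<le> t * (pi / 4)"
      using t by (auto intro!: mult_right_mono)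
    then have "th1 (of_real (t * (pi / 4) + pi / 2)) \<noteq> 0"
      using pi_gt_zero by (intro theta1_nonzero_real[OF Im_tau]) linarith+
    moreover have "of_real (t * (pi / 4) + pi / 2) = \<omega> + of_real pi / 2"
      by (simp add: t x_def)
    ultimately show ?thesis
      by (simp only: theta1_add_pi_half[OF Im_tau] not_False_eq_True)
  qed
  have "\<exists>c. \<forall>\<omega>\<in>closed_segment 0 x. th1 (x + \<omega>) * th1 (x - \<omega>) / (th2 \<omega>)\<^sup>2 = c"
  proof (rule has_field_derivative_zero_constant)
    fix \<omega> assume "\<omega> \<in> closed_segment 0 x"
    note \<omega> = nz[OF this]
    have "((\<lambda>\<omega>. th1 (x + \<omega>) * th1 (x - \<omega>) / (th2 \<omega>)\<^sup>2) has_field_derivative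
       (((deriv th1 (x + \<omega>) * th1 (x - \<omega>) - th1 (x + \<omega>) * deriv th1 (x - \<omega>)) * (th2 \<omega>)\<^sup>2
         - th1 (x + \<omega>) * th1 (x - \<omega>) * (2 * th2 \<omega> * deriv th2 \<omega>)) / ((th2 \<omega>)\<^sup>2 * (th2 \<omega>)\<^sup>2)))
       (at \<omega> within closed_segment 0 x)"
      using \<omega> Im_tau by (auto intro!: derivative_eq_intros)
    also have "(deriv th1 (x + \<omega>) * th1 (x - \<omega>) - th1 (x + \<omega>) * deriv th1 (x - \<omega>)) * (th2 \<omega>)\<^sup>2
         - th1 (x + \<omega>) * th1 (x - \<omega>) * (2 * th2 \<omega> * deriv th2 \<omega>) = 0"
      using wr[of x \<omega>] by (simp add: algebra_simps)
    finally show "((\<lambda>\<omega>. th1 (x + \<omega>) * th1 (x - \<omega>) / (th2 \<omega>)\<^sup>2) has_field_derivative 0) (at \<omega> within closed_segment 0 x)"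
      by simp
  qed simp
  then obtain c where c: "\<And>\<omega>. \<omega> \<in> closed_segment 0 x \<Longrightarrow> th1 (x + \<omega>) * th1 (x - \<omega>) / (th2 \<omega>)\<^sup>2 = c" by blast
  have "c = 0" using c[of x] by (simp add: theta1_0[OF Im_tau])
  moreover have "th1 x \<noteq> 0"
    unfolding x_def by (rule theta1_nonzero_real[OF Im_tau]) auto
  ultimately show False
    using c[of 0] nz[of 0] by simp
qed

end

text \<open>The planar curve as a function of the single complex variable z = u + i w.\<close>

definition gamma_ext :: "complex \<Rightarrow> real \<Rightarrow> complex \<Rightarrow> complex" where
  "gamma_ext \<tau> \<omega> z =
     - \<i> * crit_R \<tau> \<omega> * (theta1 ((z - 3 * of_real \<omega>) / 2) \<tau> / theta1 ((z + of_real \<omega>) / 2) \<tau>)"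

text \<open>The derivative of \<open>gamma_ext\<close> when \<omega> is critical. In this closed
  form it is visibly nonzero on the strip, and its modulus is a product of theta quotients.\<close>

definition gamma_ext' :: "complex \<Rightarrow> real \<Rightarrow> complex \<Rightarrow> complex" where
  "gamma_ext' \<tau> \<omega> z =
     - \<i> * (theta2 ((z - of_real \<omega>) / 2) \<tau> / theta1 ((z + of_real \<omega>) / 2) \<tau>)\<^sup>2"

lemma gamma_curve_eq: "gamma_curve \<tau> \<omega> u w = gamma_ext \<tau> \<omega> (of_real u + \<i> * of_real w)"
  by (simp add: gamma_curve_def gamma_ext_def)

section \<open>The planar curve on the strip 0 < Im z < 2 pi Im \<tau>\<close>

context
  fixes \<tau> :: complex and \<omega> R :: real
  assumes Im_tau: "Im \<tau> > 0" and Re_tau: "Re \<tau> = 1/2"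
    and omega: "0 < \<omega>" "\<omega> < pi / 4"
    and crit: "deriv (\<lambda>z. theta2 z \<tau>) (of_real \<omega>) = 0"
    and R: "R = Re (crit_R \<tau> \<omega>)"
begin

lemma theta2_omega_nonzero: "th2 \<tau> (of_real \<omega>) \<noteq> 0"
  using theta1_nonzero_real[OF Im_tau, of "\<omega> + pi / 2"] omega pi_gt_zero
  by (simp add: theta1_add_pi_half[OF Im_tau])

lemma theta1_2omega_nonzero: "th1 \<tau> (2 * of_real \<omega>) \<noteq> 0"
  using theta1_nonzero_real[OF Im_tau, of "2 * \<omega>"] omega pi_gt_zero by simp

lemmas cnj_theta = cnj_theta1[OF Im_tau Re_tau] cnj_theta2[OF Im_tau Re_tau]

lemma cnj_dtheta1_0: "cnj (dtheta1_0 \<tau>) = exp (- (\<i> * of_real pi / 4)) * dtheta1_0 \<tau>"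
proof -
  have d: "((\<lambda>z. th1 \<tau> z) has_field_derivative dtheta1_0 \<tau>) (at 0)"
    using theta1_has_field_derivative[OF Im_tau DERIV_ident, of 0 UNIV] by (simp add: dtheta1_0_def)
  have "cnj \<circ> (\<lambda>z. th1 \<tau> z) \<circ> cnj = (\<lambda>z. exp (- (\<i> * of_real pi / 4)) * th1 \<tau> z)"
    by (simp add: fun_eq_iff cnj_theta)
  moreover have "(cnj \<circ> (\<lambda>z. th1 \<tau> z) \<circ> cnj has_field_derivative cnj (dtheta1_0 \<tau>)) (at 0)"
    by (rule has_field_derivative_cnj_cnj) (use d in simp)
  moreover have "((\<lambda>z. exp (- (\<i> * of_real pi / 4)) * th1 \<tau> z) has_field_derivative
      exp (- (\<i> * of_real pi / 4)) * dtheta1_0 \<tau>) (at 0)"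
    by (rule DERIV_cmult[OF d])
  ultimately show ?thesis using DERIV_unique by metis
qed

text \<open>Two theta factors above and two below the fraction line, so the conjugation phases
  cancel.\<close>

lemma crit_R_eq: "crit_R \<tau> \<omega> = of_real R"
proof -
  have "cnj (crit_R \<tau> \<omega>) = crit_R \<tau> \<omega>"
    using theta1_2omega_nonzero dtheta1_0_nonzero[OF Im_tau]
    by (simp add: crit_R_def cnj_theta cnj_dtheta1_0 power2_eq_square)
  then have "crit_R \<tau> \<omega> \<in> \<real>" by (simp add: Reals_cnj_iff)
  then show ?thesis by (simp add: R)
qed

lemma R_mult: "of_real R * (dtheta1_0 \<tau> * th1 \<tau> (2 * of_real \<omega>)) = 2 * (th2 \<tau> (of_real \<omega>))\<^sup>2"
  using theta1_2omega_nonzero dtheta1_0_nonzero[OF Im_tau]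
  by (simp add: crit_R_eq[symmetric] crit_R_def)

lemma R_nonzero: "R \<noteq> 0"
  using R_mult theta2_omega_nonzero by auto

lemma cnj_theta_quotients:
  "cnj (th1 \<tau> x / th1 \<tau> y) = th1 \<tau> (cnj x) / th1 \<tau> (cnj y)"
  "cnj (th2 \<tau> x / th1 \<tau> y) = th2 \<tau> (cnj x) / th1 \<tau> (cnj y)"
  by (simp_all add: cnj_theta)

context
  fixes z :: complex
  assumes z: "0 < Im z" "Im z < 2 * pi * Im \<tau>"
begin

text \<open>Halving the argument maps the admissible range of Im z onto the strip where neither
  theta function vanishes; real translations do not matter.\<close>

lemma strip_nonzero [simp]:
  "th1 \<tau> ((z + of_real c) / 2) \<noteq> 0" "th1 \<tau> ((z - of_real c) / 2) \<noteq> 0" "th1 \<tau> ((z - 3 * of_real c) / 2) \<noteq> 0"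
  "th2 \<tau> ((z - of_real c) / 2) \<noteq> 0"
  by (rule theta1_nonzero_strip[OF Im_tau] theta2_nonzero_strip[OF Im_tau]; use z in simp)+

lemma strip_cnj_nonzero [simp]:
  "th1 \<tau> (cnj ((z + of_real c) / 2)) \<noteq> 0" "th1 \<tau> (cnj ((z - 3 * of_real c) / 2)) \<noteq> 0"
  "th2 \<tau> (cnj ((z - of_real c) / 2)) \<noteq> 0"
  using strip_nonzero[of c] arg_cong[OF cnj_theta(1)[of "(z + of_real c) / 2"], of "\<lambda>x. x = 0"]
    arg_cong[OF cnj_theta(1)[of "(z - 3 * of_real c) / 2"], of "\<lambda>x. x = 0"]
    arg_cong[OF cnj_theta(2)[of "(z - of_real c) / 2"], of "\<lambda>x. x = 0"] by auto

lemma gamma_ext_nonzero: "gamma_ext \<tau> \<omega> z \<noteq> 0"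
  by (simp add: gamma_ext_def crit_R_eq R_nonzero)

lemma gamma_ext'_nonzero: "gamma_ext' \<tau> \<omega> z \<noteq> 0"
  by (simp add: gamma_ext'_def)

lemma gamma_ext_has_field_derivative:
  "(gamma_ext \<tau> \<omega> has_field_derivative gamma_ext' \<tau> \<omega> z) (at z)"
proof -
  define x where "x = (z - of_real \<omega>) / 2"
  have x: "(z - 3 * of_real \<omega>) / 2 = x - of_real \<omega>" "(z + of_real \<omega>) / 2 = x + of_real \<omega>"
    by (simp_all add: x_def field_simps)
  have nz: "th1 \<tau> (x + of_real \<omega>) \<noteq> 0" using strip_nonzero(1)[of \<omega>] by (simp only: x not_False_eq_True)
  have g: "((\<lambda>z. (z - 3 * of_real \<omega>) / 2) has_field_derivative 1/2) (at z)"
    "((\<lambda>z. (z + of_real \<omega>) / 2) has_field_derivative 1/2) (at z)"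
    by (auto intro!: derivative_eq_intros)
  have "((\<lambda>z. - \<i> * of_real R * (th1 \<tau> ((z - 3 * of_real \<omega>) / 2) / th1 \<tau> ((z + of_real \<omega>) / 2)))
    has_field_derivative - \<i> * of_real R *
      ((deriv (th1 \<tau>) ((z - 3 * of_real \<omega>) / 2) * (1/2) * th1 \<tau> ((z + of_real \<omega>) / 2)
        - th1 \<tau> ((z - 3 * of_real \<omega>) / 2) * (deriv (th1 \<tau>) ((z + of_real \<omega>) / 2) * (1/2)))
       / (th1 \<tau> ((z + of_real \<omega>) / 2) * th1 \<tau> ((z + of_real \<omega>) / 2)))) (at z)"
    by (intro DERIV_cmult DERIV_divide theta1_has_field_derivative[OF Im_tau] g strip_nonzero)
  then have "(gamma_ext \<tau> \<omega> has_field_derivative - \<i> * of_real R *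
      ((deriv (th1 \<tau>) (x - of_real \<omega>) * (1/2) * th1 \<tau> (x + of_real \<omega>)
        - th1 \<tau> (x - of_real \<omega>) * (deriv (th1 \<tau>) (x + of_real \<omega>) * (1/2)))
       / (th1 \<tau> (x + of_real \<omega>) * th1 \<tau> (x + of_real \<omega>)))) (at z)"
    unfolding x crit_R_eq[symmetric] gamma_ext_def[symmetric] .
  also have "- \<i> * of_real R *
      ((deriv (th1 \<tau>) (x - of_real \<omega>) * (1/2) * th1 \<tau> (x + of_real \<omega>)
        - th1 \<tau> (x - of_real \<omega>) * (deriv (th1 \<tau>) (x + of_real \<omega>) * (1/2)))
       / (th1 \<tau> (x + of_real \<omega>) * th1 \<tau> (x + of_real \<omega>))) = gamma_ext' \<tau> \<omega> z"
  proof -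
    define N where "N = deriv (th1 \<tau>) (x - of_real \<omega>) * th1 \<tau> (x + of_real \<omega>) - th1 \<tau> (x - of_real \<omega>) * deriv (th1 \<tau>) (x + of_real \<omega>)"
    \<comment> \<open>Criticality removes the term with theta2'(\<omega>). By \<open>R_mult\<close>
      the radius is the constant that leaves a factor 2, which cancels the 1/2 from the inner
      derivatives.\<close>
    have "N * (th2 \<tau> (of_real \<omega>))\<^sup>2 = dtheta1_0 \<tau> * th1 \<tau> (2 * of_real \<omega>) * (th2 \<tau> x)\<^sup>2"
      using theta_wronskian[OF Im_tau, of x "of_real \<omega>"] crit by (simp add: N_def)
    then have "of_real R * N * (th2 \<tau> (of_real \<omega>))\<^sup>2 = of_real R * (dtheta1_0 \<tau> * th1 \<tau> (2 * of_real \<omega>)) * (th2 \<tau> x)\<^sup>2"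
      by (simp only: mult.assoc)
    then have "of_real R * N * (th2 \<tau> (of_real \<omega>))\<^sup>2 = 2 * (th2 \<tau> x)\<^sup>2 * (th2 \<tau> (of_real \<omega>))\<^sup>2"
      unfolding R_mult by simp
    then have "of_real R * N = 2 * (th2 \<tau> x)\<^sup>2" using theta2_omega_nonzero by simp
    then show ?thesis
      using nz unfolding gamma_ext'_def x by (simp add: N_def field_simps power2_eq_square flip: x_def)
  qed
  finally show ?thesis .
qed

text \<open>The map z to 2\<omega> - conj z is u to 2\<omega> - u with \<open>w\<close> fixed. Up to
  sign and conjugation it exchanges the arguments of numerator and denominator, and oddness of
  theta1 does the rest.\<close>

lemma gamma_ext_reflect:
  "gamma_ext \<tau> \<omega> (2 * of_real \<omega> - cnj z) * cnj (gamma_ext \<tau> \<omega> z) = (of_real R)\<^sup>2"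
proof -
  have args: "(2 * of_real \<omega> - cnj z - 3 * of_real \<omega>) / 2 = - cnj ((z + of_real \<omega>) / 2)"
    "(2 * of_real \<omega> - cnj z + of_real \<omega>) / 2 = - cnj ((z - 3 * of_real \<omega>) / 2)"
    by (simp_all add: field_simps)
  show ?thesis
    unfolding gamma_ext_def crit_R_eq args complex_cnj_mult cnj_theta_quotients theta1_minus[OF Im_tau]
    using strip_cnj_nonzero(1,2)[of \<omega>] by (simp add: field_simps power2_eq_square)
qed

text \<open>Here the reflection is u to pi - u: at half arguments it adds a quarter period, which
  exchanges theta1 with theta2 and so inverts the quotient.\<close>

lemma gamma_ext'_reflect:
  "gamma_ext' \<tau> \<omega> (of_real pi - cnj z) * cnj (gamma_ext' \<tau> \<omega> z) = 1"
proof -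
  have args: "(of_real pi - cnj z - of_real \<omega>) / 2 = - cnj ((z + of_real \<omega>) / 2) + of_real pi / 2"
    "(of_real pi - cnj z + of_real \<omega>) / 2 = - cnj ((z - of_real \<omega>) / 2) + of_real pi / 2"
    by (simp_all add: field_simps)
  show ?thesis
    unfolding gamma_ext'_def args complex_cnj_mult complex_cnj_power cnj_theta_quotients
      theta1_add_pi_half[OF Im_tau] theta2_add_pi_half[OF Im_tau] theta1_minus[OF Im_tau] theta2_minus[OF Im_tau]
    using strip_cnj_nonzero(1,3)[of \<omega>] by (simp add: field_simps power2_eq_square)
qed

lemma norm_gamma_ext':
  "of_real (norm (gamma_ext' \<tau> \<omega> z)) =
   th2 \<tau> ((z - of_real \<omega>) / 2) / th1 \<tau> ((z + of_real \<omega>) / 2) *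
   (th2 \<tau> (cnj ((z - of_real \<omega>) / 2)) / th1 \<tau> (cnj ((z + of_real \<omega>) / 2)))"
  unfolding cnj_theta_quotients[symmetric] complex_norm_square[symmetric] gamma_ext'_def
  by (simp add: norm_mult norm_power)

lemma gamma_ext_W1:
  "2 * Re (gamma_ext \<tau> \<omega> z * cnj (W1 \<tau> \<omega> (Im z))) = norm (gamma_ext' \<tau> \<omega> z)"
proof -
  define x where "x = (z - of_real \<omega>) / 2"
  define d where "d = \<i> * of_real (Im z)"
  have x: "(z - 3 * of_real \<omega>) / 2 = x - of_real \<omega>" "(z + of_real \<omega>) / 2 = x + of_real \<omega>"
    by (simp_all add: x_def field_simps)
  \<comment> \<open>Conjugation becomes translation by \<open>d\<close>, so a holomorphic identity
    in \<open>x\<close> and \<open>d\<close> suffices.\<close>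
  have y: "cnj x = x - d" by (simp add: x_def d_def complex_eq_iff)
  define A where "A = \<i> * (dtheta1_0 \<tau> / (2 * th2 \<tau> (of_real \<omega>))) / th1 \<tau> d"
  have d0: "th1 \<tau> d \<noteq> 0"
    unfolding d_def by (rule theta1_nonzero_imag[OF Im_tau Re_tau z])
  have W: "W1 \<tau> \<omega> (Im z) = A * th2 \<tau> (of_real \<omega> - d)"
    by (simp add: W1_def A_def d_def)
  have "cnj d = - d" by (simp add: d_def)
  \<comment> \<open>One theta factor above and two below leave a phase in \<open>cnj A\<close>; the
    remaining theta2 factor of \<open>W1\<close> supplies its compensation.\<close>
  then have A: "cnj A * exp (- (\<i> * of_real pi / 4)) = A"
    by (simp add: A_def cnj_theta cnj_dtheta1_0 theta1_minus[OF Im_tau])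
  have W': "cnj (W1 \<tau> \<omega> (Im z)) = A * th2 \<tau> (of_real \<omega> + d)"
  proof -
    have "cnj (W1 \<tau> \<omega> (Im z)) = (cnj A * exp (- (\<i> * of_real pi / 4))) * th2 \<tau> (of_real \<omega> + d)"
      unfolding W using \<open>cnj d = - d\<close> by (simp add: cnj_theta)
    then show ?thesis unfolding A .
  qed
  have nz: "th1 \<tau> (x + of_real \<omega>) \<noteq> 0" "th1 \<tau> (x - d + of_real \<omega>) \<noteq> 0"
    using strip_nonzero(1)[of \<omega>] strip_cnj_nonzero(1)[of \<omega>] unfolding x complex_cnj_add y by simp_all
  have cg: "cnj (gamma_ext \<tau> \<omega> z) = \<i> * of_real R * (th1 \<tau> (x - d - of_real \<omega>) / th1 \<tau> (x - d + of_real \<omega>))"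
    unfolding gamma_ext_def crit_R_eq x complex_cnj_mult cnj_theta_quotients
    by (simp add: y)
  have AR: "- \<i> * of_real R * A * (th1 \<tau> d * th1 \<tau> (2 * of_real \<omega>)) = th2 \<tau> (of_real \<omega>)"
  proof -
    have "- \<i> * of_real R * A * (th1 \<tau> d * th1 \<tau> (2 * of_real \<omega>)) =
        of_real R * (dtheta1_0 \<tau> * th1 \<tau> (2 * of_real \<omega>)) / (2 * th2 \<tau> (of_real \<omega>))"
      using d0 by (simp add: A_def mult.left_commute[of "of_real R" "\<i>"])
    also have "\<dots> = th2 \<tau> (of_real \<omega>)"
      unfolding R_mult using theta2_omega_nonzero by (simp add: power2_eq_square)
    finally show ?thesis .
  qed
  have re: "of_real (2 * Re q) = q + cnj q" for q by (simp add: complex_add_cnj)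
  define u v where "u = th1 \<tau> (x + of_real \<omega>)" and "v = th1 \<tau> (x - d + of_real \<omega>)"
  have uv: "u \<noteq> 0" "v \<noteq> 0" unfolding u_def v_def by (fact nz)+
  define a b where "a = th2 \<tau> (of_real \<omega> + d) * th1 \<tau> (x - of_real \<omega>)"
    and "b = th2 \<tau> (of_real \<omega> - d) * th1 \<tau> (x - d - of_real \<omega>)"
  define t where "t = th2 \<tau> (of_real \<omega>)"
  have sum: "complex_of_real (2 * Re (gamma_ext \<tau> \<omega> z * cnj (W1 \<tau> \<omega> (Im z)))) = - \<i> * of_real R * A * (a / u - b / v)"
  proof -
    have "complex_of_real (2 * Re (gamma_ext \<tau> \<omega> z * cnj (W1 \<tau> \<omega> (Im z)))) =
      gamma_ext \<tau> \<omega> z * cnj (W1 \<tau> \<omega> (Im z)) + cnj (gamma_ext \<tau> \<omega> z) * W1 \<tau> \<omega> (Im z)"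
      unfolding re by simp
    also have "\<dots> = - \<i> * of_real R * A * (a / u - b / v)"
      unfolding cg W' unfolding W unfolding gamma_ext_def crit_R_eq x by (simp add: a_def b_def u_def v_def algebra_simps)
    finally show ?thesis .
  qed
  \<comment> \<open>The factor \<open>t\<close> = theta2(\<omega>) is what
    \<open>theta_addition\<close> needs for the numerator over the common denominator u v; it
    cancels at the end.\<close>
  have "- \<i> * of_real R * A * (a / u - b / v) * t = (- \<i> * of_real R * A) * (a * v * t - b * u * t) / (u * v)"
    using uv by (simp add: field_simps)
  also have "a * v * t - b * u * t = th1 \<tau> d * th1 \<tau> (2 * of_real \<omega>) * th2 \<tau> x * th2 \<tau> (x - d)"
    unfolding a_def b_def u_def v_def t_def using theta_addition[OF Im_tau, of "of_real \<omega>" d x] .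
  also have "(- \<i> * of_real R * A) * \<dots> = (- \<i> * of_real R * A * (th1 \<tau> d * th1 \<tau> (2 * of_real \<omega>))) * (th2 \<tau> x * th2 \<tau> (x - d))"
    by (simp only: mult.assoc)
  also have "\<dots> / (u * v) = complex_of_real (norm (gamma_ext' \<tau> \<omega> z)) * t"
    unfolding AR norm_gamma_ext' u_def v_def t_def x complex_cnj_add y
    by (simp add: x_def[symmetric] y)
  finally have "complex_of_real (norm (gamma_ext' \<tau> \<omega> z)) * t = - \<i> * of_real R * A * (a / u - b / v) * t" ..
  then have "complex_of_real (2 * Re (gamma_ext \<tau> \<omega> z * cnj (W1 \<tau> \<omega> (Im z)))) = of_real (norm (gamma_ext' \<tau> \<omega> z))"
    unfolding sum using theta2_omega_nonzero by (metis mult_right_cancel t_def)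
  then show ?thesis by (simp only: of_real_eq_iff)
qed

text \<open>Re z = \<omega> is the fixed line of z to 2\<omega> - conj z, which gives the modulus.
  On it (z - \<omega>)/2 is imaginary, so evenness makes theta2 agree there and at the conjugate
  point.\<close>

lemma gamma_ext_at_omega:
  assumes "Re z = \<omega>"
  shows "norm (gamma_ext \<tau> \<omega> z) = \<bar>R\<bar>"
    and "of_real R * gamma_ext' \<tau> \<omega> z = - of_real (norm (gamma_ext' \<tau> \<omega> z)) * gamma_ext \<tau> \<omega> z"
proof -
  have "2 * of_real \<omega> - cnj z = z" using assms by (simp add: complex_eq_iff)
  then have "of_real ((norm (gamma_ext \<tau> \<omega> z))\<^sup>2) = complex_of_real (R\<^sup>2)"
    using gamma_ext_reflect complex_norm_square[of "gamma_ext \<tau> \<omega> z"] by simp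
  then have "(norm (gamma_ext \<tau> \<omega> z))\<^sup>2 = R\<^sup>2" using of_real_eq_iff by blast
  then show "norm (gamma_ext \<tau> \<omega> z) = \<bar>R\<bar>"
    by (metis norm_ge_zero real_sqrt_abs real_sqrt_unique)
  have args: "(z - 3 * of_real \<omega>) / 2 = - cnj ((z + of_real \<omega>) / 2)" "cnj ((z - of_real \<omega>) / 2) = - ((z - of_real \<omega>) / 2)"
    using assms by (simp_all add: complex_eq_iff)
  show "of_real R * gamma_ext' \<tau> \<omega> z = - of_real (norm (gamma_ext' \<tau> \<omega> z)) * gamma_ext \<tau> \<omega> z"
    unfolding norm_gamma_ext' unfolding gamma_ext_def gamma_ext'_def crit_R_eq args theta1_minus[OF Im_tau] theta2_minus[OF Im_tau]
    using strip_cnj_nonzero(1)[of \<omega>] by (simp add: field_simps power2_eq_square)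
qed

end

text \<open>At half arguments this is a shift by pi, and both theta1 factors change sign.\<close>

lemma gamma_ext_add_2pi: "gamma_ext \<tau> \<omega> (z + 2 * of_real pi) = gamma_ext \<tau> \<omega> z"
proof -
  have args: "(z + 2 * of_real pi - 3 * of_real \<omega>) / 2 = (z - 3 * of_real \<omega>) / 2 + of_real pi"
    "(z + 2 * of_real pi + of_real \<omega>) / 2 = (z + of_real \<omega>) / 2 + of_real pi"
    by (simp_all add: field_simps)
  show ?thesis
    unfolding gamma_ext_def args theta1_add_pi[OF Im_tau] by simp
qed

end

section \<open>Quaternions and complex numbers\<close>

lemma quat_of_complex_simps [simp]:
  "q_re (quat_of_complex z) = Re z" "q_i (quat_of_complex z) = Im z"
  "q_j (quat_of_complex z) = 0" "q_k (quat_of_complex z) = 0"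
  by (simp_all add: quat_of_complex_def)

lemma quat_unit_sel [simp]:
  "q_re quat_j = 0" "q_i quat_j = 0" "q_j quat_j = 1" "q_k quat_j = 0"
  "q_re quat_k = 0" "q_i quat_k = 0" "q_j quat_k = 0" "q_k quat_k = 1"
  by (simp_all add: quat_j_def quat_k_def)

lemma quat_of_complex_scaleR: "quat_of_complex (r *\<^sub>R z) = r *\<^sub>R quat_of_complex z"
  by (simp add: quat_eq_iff)

lemma norm_quat_eq: "norm x = sqrt ((q_re x)\<^sup>2 + (q_i x)\<^sup>2 + (q_j x)\<^sup>2 + (q_k x)\<^sup>2)"
  by (simp add: norm_quat_def inner_quat_def power2_eq_square)

lemma norm_complex_j_plus:
  "norm (quat_of_complex a * quat_j + quat_of_complex b) = sqrt ((cmod a)\<^sup>2 + (cmod b)\<^sup>2)"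
  by (simp add: norm_quat_eq cmod_power2 add_ac)

lemma norm_complex_j: "norm (quat_of_complex a * quat_j) = cmod a"
  by (simp add: norm_quat_eq cmod_def)

text \<open>Moving j or k past a complex number conjugates it. The result is a multiple of i, hence
  orthogonal to the plane spanned by j and k in which the curve lies.\<close>

lemma commutator_complex_j_k:
  "quat_of_complex g * quat_j * (quat_of_complex a * quat_k) - quat_of_complex a * quat_k * (quat_of_complex g * quat_j)
   = quat_of_complex (\<i> * of_real (2 * Re (g * cnj a)))"
  by (simp add: quat_eq_iff algebra_simps)

lemma bounded_linear_complex_j: "bounded_linear (\<lambda>z. quat_of_complex z * quat_j)"
proof (rule bounded_linear_intro[of _ 1])
  show "norm (quat_of_complex x * quat_j) \<le> norm x * 1" for x
    by (simp add: norm_complex_j)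
qed (simp_all add: quat_eq_iff)

text \<open>The minus sign is why f^inv carries one: on imaginary quaternions -R^2 times the inverse
  is geometric inversion.\<close>

lemma inverse_imag_quat:
  assumes "q_re x = 0"
  shows "inverse x = - ((1 / (norm x)\<^sup>2) *\<^sub>R x)"
  using assms by (simp add: inverse_quat_def norm_quat_eq quat_eq_iff)

lemma q_re_conj:
  assumes "p \<noteq> (0::quat)"
  shows "q_re (inverse p * x * p) = q_re x"
proof -
  have comm: "q_re (a * b) = q_re (b * a)" for a b by (simp add: mult.commute)
  have "q_re (inverse p * x * p) = q_re (p * (inverse p * x))" by (rule comm)
  also have "p * (inverse p * x) = x" using assms by (simp flip: mult.assoc)
  finally show ?thesis .
qed

lemma norm_conj:
  assumes "p \<noteq> (0::quat)"
  shows "norm (inverse p * x * p) = norm x"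
  using assms by (simp add: norm_mult norm_inverse)

lemma bounded_linear_conj: "bounded_linear (\<lambda>x. inverse p * x * (p::quat))"
  by (intro bounded_linear_compose[OF bounded_linear_mult_left bounded_linear_mult_right])

section \<open>Inversion in a sphere\<close>

lemma sphere_inversion_involutive:
  assumes "R \<noteq> 0" "x \<noteq> 0"
  shows "sphere_inversion R (sphere_inversion R x) = x"
  using assms by (simp add: sphere_inversion_def power2_eq_square field_simps)

lemma sphere_inversion_image_subspace:
  assumes "subspace S" "R \<noteq> 0"
  shows "sphere_inversion R ` (S - {0}) = S - {0}"
proof
  show sub: "sphere_inversion R ` (S - {0}) \<subseteq> S - {0}"
    using assms by (auto simp: sphere_inversion_def subspace_scale)
  show "S - {0} \<subseteq> sphere_inversion R ` (S - {0})"
  proof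
    fix x assume x: "x \<in> S - {0}"
    then have "sphere_inversion R x \<in> S - {0}" using sub by blast
    moreover have "x = sphere_inversion R (sphere_inversion R x)"
      using x assms(2) by (simp add: sphere_inversion_involutive)
    ultimately show "x \<in> sphere_inversion R ` (S - {0})" by (rule rev_image_eqI)
  qed
qed

section \<open>Christoffel duality\<close>

text \<open>On nonzero vectors a to a/|a|^2 and its negative are involutions.\<close>

lemma christoffel_dual_sym:
  assumes "christoffel_dual f g"
  shows "christoffel_dual g f"
proof -
  have inv: "a = b /\<^sub>R (norm b)\<^sup>2" if "b = a /\<^sub>R (norm a)\<^sup>2" "a \<noteq> 0" for a b :: quat
    using that(2) unfolding that(1) by (simp add: power2_eq_square field_simps)
  have inv': "a = - (b /\<^sub>R (norm b)\<^sup>2)" if "b = - (a /\<^sub>R (norm a)\<^sup>2)" "a \<noteq> 0" for a b :: quat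
    using inv[of "- b" a] that by (simp add: scaleR_minus_right)
  have nz: "b \<noteq> 0" if "b = a /\<^sub>R (norm a)\<^sup>2 \<or> b = - (a /\<^sub>R (norm a)\<^sup>2)" "a \<noteq> 0" for a b :: quat
    using that by auto
  show ?thesis
    unfolding christoffel_dual_def
  proof (intro allI)
    fix u v
    have *: "pd_u f u v \<noteq> 0" "pd_v f u v \<noteq> 0" "pd_u g u v = pd_u f u v /\<^sub>R (norm (pd_u f u v))\<^sup>2"
      "pd_v g u v = - (pd_v f u v /\<^sub>R (norm (pd_v f u v))\<^sup>2)"
      using assms unfolding christoffel_dual_def by blast+
    show "(\<lambda>x. g x v) differentiable at u \<and> (\<lambda>y. g u y) differentiable at v \<and>
        (\<lambda>x. f x v) differentiable at u \<and> (\<lambda>y. f u y) differentiable at v \<and>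
        pd_u g u v \<noteq> 0 \<and> pd_v g u v \<noteq> 0 \<and>
        pd_u f u v = pd_u g u v /\<^sub>R (norm (pd_u g u v))\<^sup>2 \<and>
        pd_v f u v = - (pd_v g u v /\<^sub>R (norm (pd_v g u v))\<^sup>2)"
      using assms inv[OF *(3,1)] inv'[OF *(4,2)] nz[OF disjI1[OF *(3)] *(1)] nz[OF disjI2[OF *(4)] *(2)]
      unfolding christoffel_dual_def by blast
  qed
qed

section \<open>Planes of closed curves\<close>

text \<open>If the curve lay in a line, Rolle's theorem along that line would give a singular point.\<close>

lemma affine_hull_closed_regular_curve:
  fixes c c' :: "real \<Rightarrow> complex"
  assumes deriv: "\<And>t. (c has_vector_derivative c' t) (at t)" and regular: "\<And>t. c' t \<noteq> 0"
    and "a < b" and closed: "c a = c b"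
  shows "affine hull (range c) = UNIV"
proof (rule ccontr)
  assume "affine hull (range c) \<noteq> UNIV"
  then have "aff_dim (range c) \<noteq> int DIM(complex)"
    unfolding aff_dim_eq_full .
  then have "aff_dim (range c) < int DIM(complex)"
    using aff_dim_le_DIM[of "range c"] by linarith
  then obtain n r where n: "n \<noteq> 0" "range c \<subseteq> {x. n \<bullet> x = r}"
    by (rule aff_lowdim_subset_hyperplane)
  have d: "((\<lambda>t. m \<bullet> c t) has_real_derivative m \<bullet> c' t) (at t)" for m t
    using bounded_linear.has_vector_derivative[OF bounded_linear_inner_right deriv]
    by (simp add: has_real_derivative_iff_has_vector_derivative)
  have "\<exists>t>a. t < b \<and> DERIV (\<lambda>t. (\<i> * n) \<bullet> c t) t :> 0"
  proof (rule Rolle)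
    show "continuous_on {a..b} (\<lambda>t. (\<i> * n) \<bullet> c t)"
      using d by (intro continuous_at_imp_continuous_on ballI DERIV_isCont) blast
  qed (use d assms(3) closed in \<open>auto simp: real_differentiable_def\<close>)
  then obtain t where "DERIV (\<lambda>t. (\<i> * n) \<bullet> c t) t :> 0" by blast
  then have 1: "(\<i> * n) \<bullet> c' t = 0" using d DERIV_unique by blast
  have "(\<lambda>t. n \<bullet> c t) = (\<lambda>_. r)" using n(2) by auto
  then have "DERIV (\<lambda>t. n \<bullet> c t) t :> 0" by simp
  then have 2: "n \<bullet> c' t = 0" using d DERIV_unique by blast
  have "(cmod n)\<^sup>2 * (cmod (c' t))\<^sup>2 = (n \<bullet> c' t)\<^sup>2 + ((\<i> * n) \<bullet> c' t)\<^sup>2"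
    unfolding cmod_power2 inner_complex_def by (simp add: power2_eq_square algebra_simps)
  then show False using 1 2 n(1) regular by simp
qed

section \<open>The surface in normal form\<close>

context
  fixes \<tau> :: complex and \<omega> R :: real and w s :: "real \<Rightarrow> real"
    and \<Phi> :: "real \<Rightarrow> quat" and f :: "real \<Rightarrow> real \<Rightarrow> quat"
  assumes Im_tau: "Im \<tau> > 0" and Re_tau: "Re \<tau> = 1/2"
    and omega: "0 < \<omega>" "\<omega> < pi / 4"
    and crit: "deriv (\<lambda>z. theta2 z \<tau>) (of_real \<omega>) = 0"
    and R: "R = Re (crit_R \<tau> \<omega>)"
    and nf: "normal_form \<tau> \<omega> w s \<Phi> f"
begin

definition "zpt u v = complex_of_real u + \<i> * of_real (w v)"

abbreviation (input) "gam u v \<equiv> gamma_ext \<tau> \<omega> (zpt u v)"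
abbreviation (input) "gam' u v \<equiv> gamma_ext' \<tau> \<omega> (zpt u v)"

lemma Im_zpt: "0 < Im (zpt u v)" "Im (zpt u v) < 2 * pi * Im \<tau>"
  using nf by (simp_all add: normal_form_def tau_admissible_def zpt_def)

lemmas gam_facts =
  gamma_ext_nonzero[OF Im_tau Re_tau omega crit R Im_zpt]
  gamma_ext'_nonzero[OF Im_tau Re_tau omega crit R Im_zpt]

lemma Phi_nonzero: "\<Phi> v \<noteq> 0"
  using nf by (simp add: normal_form_def)

lemma f_eq: "f u v = inverse (\<Phi> v) * (quat_of_complex (gam u v) * quat_j) * \<Phi> v"
  using nf by (simp add: normal_form_def gamma_curve_eq zpt_def mult.assoc)

lemma w_deriv: "(w has_real_derivative deriv w v) (at v)"
proof -
  have "w differentiable_on UNIV"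
    using nf unfolding normal_form_def tau_admissible_def smooth_fun_def
    by (metis funpow_0)
  then show ?thesis
    by (simp add: differentiable_on_def DERIV_deriv_iff_real_differentiable)
qed

lemma Phi_deriv:
  "(\<Phi> has_vector_derivative quat_of_complex (of_real (s v) * W1 \<tau> \<omega> (w v)) * quat_k * \<Phi> v) (at v)"
proof -
  have "(\<Phi> has_vector_derivative vector_derivative \<Phi> (at v)) (at v)"
    using nf by (simp add: normal_form_def vector_derivative_works)
  moreover have "vector_derivative \<Phi> (at v) = vector_derivative \<Phi> (at v) * inverse (\<Phi> v) * \<Phi> v"
    using Phi_nonzero[of v] by (simp add: mult.assoc)
  ultimately show ?thesis
    using nf by (simp add: normal_form_def)
qed

lemma gam_u_deriv: "((\<lambda>u. gam u v) has_vector_derivative gam' u v) (at u)"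
proof -
  have "((\<lambda>u. zpt u v) has_vector_derivative 1) (at u)"
    unfolding zpt_def by (auto intro!: derivative_eq_intros)
  from field_vector_diff_chain_at[OF this gamma_ext_has_field_derivative[OF Im_tau Re_tau omega crit R Im_zpt]]
  show ?thesis by (simp add: o_def)
qed

lemma gam_v_deriv: "((\<lambda>v. gam u v) has_vector_derivative \<i> * of_real (deriv w v) * gam' u v) (at v)"
proof -
  have "((\<lambda>v. zpt u v) has_vector_derivative \<i> * of_real (deriv w v)) (at v)"
    unfolding zpt_def by (auto intro!: derivative_eq_intros w_deriv)
  from field_vector_diff_chain_at[OF this gamma_ext_has_field_derivative[OF Im_tau Re_tau omega crit R Im_zpt]]
  show ?thesis by (simp add: o_def)
qed

section \<open>First derivatives and conformality of the surface\<close>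

lemma f_u_deriv:
  "((\<lambda>u. f u v) has_vector_derivative inverse (\<Phi> v) * (quat_of_complex (gam' u v) * quat_j) * \<Phi> v) (at u)"
  unfolding f_eq
  by (rule bounded_linear.has_vector_derivative[OF bounded_linear_compose[OF bounded_linear_conj bounded_linear_complex_j] gam_u_deriv])

lemma f_v_deriv:
  "((\<lambda>v. f u v) has_vector_derivative inverse (\<Phi> v) *
     (quat_of_complex (\<i> * of_real (deriv w v) * gam' u v) * quat_j
       + quat_of_complex (\<i> * of_real (s v * cmod (gam' u v)))) * \<Phi> v) (at v)"
proof -
  define m where "m = (\<lambda>v. quat_of_complex (gam u v) * quat_j)"
  define m' where "m' = quat_of_complex (\<i> * of_real (deriv w v) * gam' u v) * quat_j"
  define P where "P = quat_of_complex (of_real (s v) * W1 \<tau> \<omega> (w v)) * quat_k"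
  have inv: "((\<lambda>v. inverse (\<Phi> v)) has_vector_derivative - (inverse (\<Phi> v) * P)) (at v)"
  proof -
    have "((\<lambda>v. inverse (\<Phi> v)) has_derivative
        (\<lambda>h. - (inverse (\<Phi> v) * (h *\<^sub>R (P * \<Phi> v)) * inverse (\<Phi> v)))) (at v)"
      using Phi_deriv[of v, folded P_def] unfolding has_vector_derivative_def
      by (rule Deriv.has_derivative_inverse[where f = \<Phi>, OF Phi_nonzero])
    also have "(\<lambda>h. - (inverse (\<Phi> v) * (h *\<^sub>R (P * \<Phi> v)) * inverse (\<Phi> v))) = (\<lambda>h. h *\<^sub>R - (inverse (\<Phi> v) * P))"
      using Phi_nonzero[of v] by (simp add: mult.assoc fun_eq_iff)
    finally show ?thesis unfolding has_vector_derivative_def .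
  qed
  have m: "(m has_vector_derivative m') (at v)"
    unfolding m_def m'_def by (rule bounded_linear.has_vector_derivative[OF bounded_linear_complex_j gam_v_deriv])
  have "((\<lambda>v. inverse (\<Phi> v) * m v * \<Phi> v) has_vector_derivative
      inverse (\<Phi> v) * m v * (P * \<Phi> v) + (inverse (\<Phi> v) * m' + - (inverse (\<Phi> v) * P) * m v) * \<Phi> v) (at v)"
    by (intro has_vector_derivative_mult inv m Phi_deriv[of v, folded P_def])
  also have "inverse (\<Phi> v) * m v * (P * \<Phi> v) + (inverse (\<Phi> v) * m' + - (inverse (\<Phi> v) * P) * m v) * \<Phi> v
      = inverse (\<Phi> v) * (m' + (m v * P - P * m v)) * \<Phi> v"
    by (simp add: algebra_simps)
  \<comment> \<open>The rotation of the plane contributes only along its normal, with the length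
    that \<open>gamma_ext_W1\<close> evaluates.\<close>
  also have "m v * P - P * m v = quat_of_complex (\<i> * of_real (s v * (2 * Re (gam u v * cnj (W1 \<tau> \<omega> (w v))))))"
    unfolding m_def P_def commutator_complex_j_k by (simp add: algebra_simps)
  also have "2 * Re (gam u v * cnj (W1 \<tau> \<omega> (w v))) = cmod (gam' u v)"
    using gamma_ext_W1[OF Im_tau Re_tau omega crit R Im_zpt, of u v] by (simp add: zpt_def)
  finally show ?thesis
    unfolding f_eq m_def m'_def .
qed

lemma pd_u_f: "pd_u f u v = inverse (\<Phi> v) * (quat_of_complex (gam' u v) * quat_j) * \<Phi> v"
  unfolding pd_u_def by (rule vector_derivative_at[OF f_u_deriv])

lemma pd_v_f:
  "pd_v f u v = inverse (\<Phi> v) *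
     (quat_of_complex (\<i> * of_real (deriv w v) * gam' u v) * quat_j
       + quat_of_complex (\<i> * of_real (s v * cmod (gam' u v)))) * \<Phi> v"
  unfolding pd_v_def by (rule vector_derivative_at[OF f_v_deriv])

lemma norm_pd_u_f: "norm (pd_u f u v) = cmod (gam' u v)"
  unfolding pd_u_f by (simp add: norm_conj[OF Phi_nonzero] norm_complex_j)

lemma norm_pd_v_f: "norm (pd_v f u v) = cmod (gam' u v)"
proof -
  have "(deriv w v)\<^sup>2 + (s v)\<^sup>2 = 1"
    using nf by (simp add: normal_form_def tau_admissible_def)
  then have "(cmod (\<i> * of_real (deriv w v) * gam' u v))\<^sup>2 + (cmod (\<i> * of_real (s v * cmod (gam' u v))))\<^sup>2
      = (cmod (gam' u v))\<^sup>2"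
    by (simp add: norm_mult power_mult_distrib flip: distrib_right)
  then show ?thesis
    unfolding pd_v_f norm_conj[OF Phi_nonzero] norm_complex_j_plus by simp
qed

lemma norm_f: "norm (f u v) = cmod (gam u v)"
  unfolding f_eq by (simp add: norm_conj[OF Phi_nonzero] norm_complex_j)

lemma f_reflect: "f (2 * \<omega> - u) v = sphere_inversion R (f u v)"
proof -
  have "zpt (2 * \<omega> - u) v = 2 * of_real \<omega> - cnj (zpt u v)" by (simp add: zpt_def)
  then have "gam (2 * \<omega> - u) v * (cnj (gam u v) * gam u v) = (of_real R)\<^sup>2 * gam u v"
    using gamma_ext_reflect[OF Im_tau Re_tau omega crit R Im_zpt, of u v] by (simp add: mult.assoc[symmetric])
  then have "gam (2 * \<omega> - u) v = (R\<^sup>2 / (cmod (gam u v))\<^sup>2) *\<^sub>R gam u v"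
    using gam_facts(1)[of u v] complex_norm_square[of "gam u v"] by (simp add: scaleR_conv_of_real field_simps)
  then show ?thesis
    unfolding sphere_inversion_def norm_f unfolding f_eq
    by (simp add: quat_of_complex_scaleR)
qed

lemma gam'_reflect: "gam' (pi - u) v = (1 / (cmod (gam' u v))\<^sup>2) *\<^sub>R gam' u v"
proof -
  have "zpt (pi - u) v = of_real pi - cnj (zpt u v)" by (simp add: zpt_def)
  then have "gam' (pi - u) v * (cnj (gam' u v) * gam' u v) = gam' u v"
    using gamma_ext'_reflect[OF Im_tau Re_tau omega crit R Im_zpt, of u v] by (simp add: mult.assoc[symmetric])
  then show ?thesis
    using gam_facts(2)[of u v] complex_norm_square[of "gam' u v"] by (simp add: scaleR_conv_of_real field_simps)
qed

text \<open>The closed regular planar curve spans the whole of C, and conjugation by the fixed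
  \<open>\<Phi> v\<close> is linear; in particular the plane contains the origin.\<close>

lemma u_plane_f: "u_plane f v = range (\<lambda>z. inverse (\<Phi> v) * (quat_of_complex z * quat_j) * \<Phi> v)"
proof -
  have "affine hull (range (\<lambda>u. gam u v)) = UNIV"
  proof (rule affine_hull_closed_regular_curve[OF gam_u_deriv gam_facts(2)])
    show "(0::real) < 2 * pi" by simp
    have "zpt (2 * pi) v = zpt 0 v + 2 * of_real pi" by (simp add: zpt_def)
    then show "gam 0 v = gam (2 * pi) v"
      using gamma_ext_add_2pi[OF Im_tau Re_tau omega crit R] by simp
  qed
  moreover have "bounded_linear (\<lambda>z. inverse (\<Phi> v) * (quat_of_complex z * quat_j) * \<Phi> v)"
    by (rule bounded_linear_compose[OF bounded_linear_conj bounded_linear_complex_j])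
  from affine_hull_linear_image[OF this, of "range (\<lambda>u. gam u v)"]
  have "range (\<lambda>z. inverse (\<Phi> v) * (quat_of_complex z * quat_j) * \<Phi> v) = u_plane f v" if "affine hull (range (\<lambda>u. gam u v)) = UNIV"
    unfolding that u_plane_def by (simp add: image_image f_eq)
  ultimately show ?thesis by simp
qed

lemma subspace_u_plane_f: "subspace (u_plane f v)"
  unfolding u_plane_f
  by (intro linear_subspace_image bounded_linear.linear
      bounded_linear_compose[OF bounded_linear_conj bounded_linear_complex_j] subspace_UNIV)

lemma aff_dim_u_plane_f: "aff_dim (u_plane f v) = 2"
proof -
  have lin: "linear (\<lambda>z. inverse (\<Phi> v) * (quat_of_complex z * quat_j) * \<Phi> v)"
    by (intro bounded_linear.linear bounded_linear_compose[OF bounded_linear_conj bounded_linear_complex_j])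
  have "inj (\<lambda>z. inverse (\<Phi> v) * (quat_of_complex z * quat_j) * \<Phi> v)"
    unfolding linear_injective_0[OF lin]
    by (metis norm_complex_j norm_conj[OF Phi_nonzero] norm_eq_zero)
  then show ?thesis
    unfolding u_plane_f by (simp add: aff_dim_injective_linear_image[OF lin])
qed

text \<open>In the u-derivative the sign of -f cancels that of pi - u; in the v-derivative only the
  first occurs. This gives the opposite signs in the definition of the dual.\<close>

lemma christoffel_dual_f: "christoffel_dual f (\<lambda>u v. - f (pi - u) v)"
  unfolding christoffel_dual_def
proof (intro allI conjI)
  fix u v
  define C where "C = (\<lambda>x. inverse (\<Phi> v) * x * \<Phi> v)"
  show "(\<lambda>x. f x v) differentiable at u" "(\<lambda>y. f u y) differentiable at v"
    using f_u_deriv f_v_deriv by (blast intro: differentiableI_vector)+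
  have "((\<lambda>x. pi - x) has_vector_derivative - 1) (at u)"
    by (auto intro!: derivative_eq_intros)
  from vector_diff_chain_at[OF this f_u_deriv[of v "pi - u"]]
  have gu: "((\<lambda>x. - f (pi - x) v) has_vector_derivative pd_u f (pi - u) v) (at u)"
    using has_vector_derivative_minus by (fastforce simp: o_def pd_u_f)
  then show "(\<lambda>x. - f (pi - x) v) differentiable at u" by (rule differentiableI_vector)
  have gv: "((\<lambda>y. - f (pi - u) y) has_vector_derivative - pd_v f (pi - u) v) (at v)"
    unfolding pd_v_f by (rule has_vector_derivative_minus[OF f_v_deriv])
  then show "(\<lambda>y. - f (pi - u) y) differentiable at v" by (rule differentiableI_vector)
  show "pd_u f u v \<noteq> 0" "pd_v f u v \<noteq> 0"
    using gam_facts(2)[of u v] norm_pd_u_f[of u v] norm_pd_v_f[of u v] by auto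
  have "pd_u f (pi - u) v = C (quat_of_complex (gam' u v) * quat_j) /\<^sub>R (cmod (gam' u v))\<^sup>2"
    unfolding pd_u_f gam'_reflect quat_of_complex_scaleR C_def by (simp add: divide_inverse)
  then show "pd_u (\<lambda>u v. - f (pi - u) v) u v = pd_u f u v /\<^sub>R (norm (pd_u f u v))\<^sup>2"
    unfolding norm_pd_u_f pd_u_def[of "\<lambda>u v. - f (pi - u) v"] vector_derivative_at[OF gu]
    by (simp add: pd_u_f C_def)
  \<comment> \<open>The in-plane part of f_v is linear in gamma' and the normal part in |gamma'|. As
    \<open>r\<close> is positive, the reflection scales both parts by \<open>r\<close>.\<close>
  define r where "r = 1 / (cmod (gam' u v))\<^sup>2"
  have "cmod (gam' (pi - u) v) = r * cmod (gam' u v)"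
    unfolding gam'_reflect by (simp add: r_def)
  then have "\<i> * of_real (s v * cmod (gam' (pi - u) v)) = r *\<^sub>R (\<i> * of_real (s v * cmod (gam' u v)))"
    by (simp add: scaleR_conv_of_real)
  moreover have "\<i> * of_real (deriv w v) * gam' (pi - u) v = r *\<^sub>R (\<i> * of_real (deriv w v) * gam' u v)"
    unfolding gam'_reflect r_def by simp
  ultimately have "pd_v f (pi - u) v = pd_v f u v /\<^sub>R (cmod (gam' u v))\<^sup>2"
    unfolding pd_v_f quat_of_complex_scaleR
    by (simp add: quat_of_complex_scaleR r_def divide_inverse scaleR_add_right[symmetric] del: scaleR_add_right)
  then show "pd_v (\<lambda>u v. - f (pi - u) v) u v = - (pd_v f u v /\<^sub>R (norm (pd_v f u v))\<^sup>2)"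
    unfolding norm_pd_v_f pd_v_def[of "\<lambda>u v. - f (pi - u) v"] vector_derivative_at[OF gv]
    by simp
qed

end

theorem theorem6:
  fixes \<tau> \<tau>\<^sub>0 :: complex and \<omega> R :: real and w s :: "real \<Rightarrow> real"
    and \<Phi> :: "real \<Rightarrow> quat" and f :: "real \<Rightarrow> real \<Rightarrow> quat"
  assumes "Re \<tau>\<^sub>0 = 1/2" and "0 < Im \<tau>\<^sub>0" and "(deriv ^^ 2) (\<lambda>z. theta2 z \<tau>\<^sub>0) 0 = 0"
    and "Re \<tau> = 1/2" and "0 < Im \<tau>" and "Im \<tau> < Im \<tau>\<^sub>0"
    and "0 < \<omega>" and "\<omega> < pi/4" and "deriv (\<lambda>z. theta2 z \<tau>) (of_real \<omega>) = 0"
    and "normal_form \<tau> \<omega> w s \<Phi> f"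
    and "generic_u_planes f"
    and "R = Re (crit_R \<tau> \<omega>)"
  shows
    "(crit_R \<tau> \<omega> \<in> \<real> \<and>
      (\<forall>v. f \<omega> v \<in> imag_quats \<inter> sphere 0 \<bar>R\<bar>) \<and>
      (\<forall>v. collinear {0, f \<omega> v, pd_u f \<omega> v} \<and>
           (1 / R) *\<^sub>R f \<omega> v = - (pd_u f \<omega> v /\<^sub>R norm (pd_u f \<omega> v)))) \<and>
     ((\<forall>u v. f u v \<noteq> 0 \<and>
             (- (R\<^sup>2)) *\<^sub>R inverse (f u v) = sphere_inversion R (f u v) \<and>
             (- (R\<^sup>2)) *\<^sub>R inverse (f u v) = f (2 * \<omega> - u) v) \<and>
      sphere_inversion R ` surface_points f = surface_points f \<and>
      (\<forall>x. x \<noteq> 0 \<longrightarrow> sphere_inversion R (sphere_inversion R x) = x) \<and>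
      (\<forall>v. aff_dim (u_plane f v) = 2 \<and>
           sphere_inversion R ` (u_plane f v - {0}) = u_plane f v - {0})) \<and>
     (christoffel_dual f (\<lambda>u v. - f (pi - u) v) \<and>
      christoffel_dual (\<lambda>u v. - f (pi - u) v) f \<and>
      surface_points (\<lambda>u v. - f (pi - u) v) = uminus ` surface_points f \<and>
      (\<forall>v. u_plane (\<lambda>u v. - f (pi - u) v) v = u_plane f v))"
proof -
  note a = assms(5,4,7,8,9,12,10)
  note Phi0 = Phi_nonzero[OF a] and norm_f = norm_f[OF a] and reflect = f_reflect[OF a]
    and plane = u_plane_f[OF a] and subspace = subspace_u_plane_f[OF a]
  have R0: "R \<noteq> 0" by (rule R_nonzero[OF a(1-6)])
  have im: "q_re (f u v) = 0" for u v
    unfolding f_eq[OF a] q_re_conj[OF Phi0] by simp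
  have f0: "f u v \<noteq> 0" for u v
    using norm_f[of u v] gam_facts(1)[OF a, of u v] by auto
  have omega_curve: "norm (f \<omega> v) = \<bar>R\<bar> \<and> R *\<^sub>R pd_u f \<omega> v = - norm (pd_u f \<omega> v) *\<^sub>R f \<omega> v" for v
  proof -
    have "Re (zpt w \<omega> v) = \<omega>" by (simp add: zpt_def[OF a])
    note at_omega = gamma_ext_at_omega[OF a(1-6) Im_zpt[OF a] this]
    show ?thesis
    proof
      show "norm (f \<omega> v) = \<bar>R\<bar>" unfolding norm_f by (rule at_omega(1))
      have *: "R *\<^sub>R gamma_ext' \<tau> \<omega> (zpt w \<omega> v) =
          - norm (pd_u f \<omega> v) *\<^sub>R gamma_ext \<tau> \<omega> (zpt w \<omega> v)"
        using at_omega(2) by (simp add: scaleR_conv_of_real norm_pd_u_f[OF a])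
      have "R *\<^sub>R pd_u f \<omega> v = inverse (\<Phi> v) * (quat_of_complex (R *\<^sub>R gamma_ext' \<tau> \<omega> (zpt w \<omega> v)) * quat_j) * \<Phi> v"
        unfolding pd_u_f[OF a] quat_of_complex_scaleR by simp
      also have "\<dots> = - norm (pd_u f \<omega> v) *\<^sub>R f \<omega> v"
        unfolding * quat_of_complex_scaleR f_eq[OF a] by simp
      finally show "R *\<^sub>R pd_u f \<omega> v = - norm (pd_u f \<omega> v) *\<^sub>R f \<omega> v" .
    qed
  qed
  have fu0: "pd_u f u v \<noteq> 0" for u v
    using gam_facts(2)[OF a, of u v] norm_pd_u_f[OF a, of u v] by auto
  have part1: "collinear {0, f \<omega> v, pd_u f \<omega> v}" "(1 / R) *\<^sub>R f \<omega> v = - (pd_u f \<omega> v /\<^sub>R norm (pd_u f \<omega> v))" for v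
  proof -
    have fu: "pd_u f \<omega> v = (- norm (pd_u f \<omega> v) / R) *\<^sub>R f \<omega> v"
    proof -
      have "pd_u f \<omega> v = (1 / R) *\<^sub>R (R *\<^sub>R pd_u f \<omega> v)" using R0 by simp
      also have "\<dots> = (- norm (pd_u f \<omega> v) / R) *\<^sub>R f \<omega> v"
        unfolding omega_curve[THEN conjunct2] by simp
      finally show ?thesis .
    qed
    then show "collinear {0, f \<omega> v, pd_u f \<omega> v}" unfolding collinear_lemma by blast
    have "norm (pd_u f \<omega> v) \<noteq> 0" using fu0 by simp
    then show "(1 / R) *\<^sub>R f \<omega> v = - (pd_u f \<omega> v /\<^sub>R norm (pd_u f \<omega> v))"
      by (subst (2) fu) simp
  qed
  have inv: "(- (R\<^sup>2)) *\<^sub>R inverse (f u v) = sphere_inversion R (f u v)" for u v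
    unfolding inverse_imag_quat[OF im] sphere_inversion_def by simp
  have mem: "f u v \<in> surface_points f" for u v
    unfolding surface_points_def by force
  have surf: "sphere_inversion R ` surface_points f = surface_points f"
  proof -
    have sub: "sphere_inversion R ` surface_points f \<subseteq> surface_points f"
    proof (intro image_subsetI)
      fix x assume "x \<in> surface_points f"
      then obtain u v where "x = f u v" by (auto simp: surface_points_def)
      then show "sphere_inversion R x \<in> surface_points f"
        using mem reflect by metis
    qed
    moreover have "x \<in> sphere_inversion R ` surface_points f" if x: "x \<in> surface_points f" for x
    proof (rule image_eqI)
      show "sphere_inversion R x \<in> surface_points f" using sub x by blast
      show "x = sphere_inversion R (sphere_inversion R x)"
        using x f0 R0 by (auto simp: surface_points_def sphere_inversion_involutive)
    qed
    ultimately show ?thesis by blast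
  qed
  have minus_range: "range (\<lambda>u. - f (pi - u) v) = uminus ` range (\<lambda>u. f u v)" for v
  proof (intro set_eqI iffI)
    fix x assume "x \<in> uminus ` range (\<lambda>u. f u v)"
    then obtain u where "x = - f u v" by auto
    then have "x = - f (pi - (pi - u)) v" by simp
    then show "x \<in> range (\<lambda>u. - f (pi - u) v)" by blast
  qed auto
  \<comment> \<open>Replacing \<open>u\<close> by \<open>pi - u\<close> only reparametrizes the
    curve, and negation preserves a plane through the origin.\<close>
  have minus_plane: "u_plane (\<lambda>u v. - f (pi - u) v) v = u_plane f v" for v
  proof -
    have "u_plane (\<lambda>u v. - f (pi - u) v) v = uminus ` u_plane f v"
      unfolding u_plane_def minus_range
      by (rule affine_hull_linear_image[symmetric]) (rule bounded_linear_minus[OF bounded_linear_ident])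
    also have "\<dots> = u_plane f v"
    proof (intro set_eqI iffI)
      fix x assume "x \<in> u_plane f v"
      then have "- x \<in> u_plane f v" by (rule subspace_neg[OF subspace])
      then show "x \<in> uminus ` u_plane f v" by (rule rev_image_eqI) simp
    qed (auto intro: subspace_neg[OF subspace])
    finally show ?thesis .
  qed
  have minus_surf: "surface_points (\<lambda>u v. - f (pi - u) v) = uminus ` surface_points f"
  proof (intro set_eqI iffI)
    fix x assume "x \<in> uminus ` surface_points f"
    then obtain u v where "x = - f u v" by (auto simp: surface_points_def)
    then have "x = - f (pi - (pi - u)) v" by simp
    then show "x \<in> surface_points (\<lambda>u v. - f (pi - u) v)"
      unfolding surface_points_def by (intro range_eqI[of _ _ "(pi - u, v)"]) simp
  qed (auto simp: surface_points_def)
  show ?thesis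
  proof (intro conjI allI impI)
    show "crit_R \<tau> \<omega> \<in> \<real>" unfolding crit_R_eq[OF a(1-6)] by simp
    show "f \<omega> v \<in> imag_quats \<inter> sphere 0 \<bar>R\<bar>" for v
      using omega_curve[of v] im by (simp add: imag_quats_def)
    show "(- (R\<^sup>2)) *\<^sub>R inverse (f u v) = f (2 * \<omega> - u) v" for u v
      unfolding inv reflect ..
    show "sphere_inversion R (sphere_inversion R x) = x" if "x \<noteq> 0" for x
      by (rule sphere_inversion_involutive[OF R0 that])
    show "sphere_inversion R ` (u_plane f v - {0}) = u_plane f v - {0}" for v
      by (rule sphere_inversion_image_subspace[OF subspace R0])
    show "christoffel_dual (\<lambda>u v. - f (pi - u) v) f"
      by (rule christoffel_dual_sym[OF christoffel_dual_f[OF a]])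
  qed (fact part1 f0 inv surf aff_dim_u_plane_f[OF a] christoffel_dual_f[OF a] minus_surf minus_plane)+
qed

end
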